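(* Let $\mu=\sum_{\lambda\in\Lambda}\mu(\lambda)\delta_\lambda$ be an atomic translation bounded measure on $\mathbb{R}^d$ (hence a tempered distribution) whose Fourier transform $\hat\mu$ is also an atomic translation bounded measure. Let $U\subset\Lambda$ and $\varepsilon>0$ be such that for all $\lambda\in U$: (i) $|\mu(\lambda)|\ge\varepsilon$, and (ii) $|\lambda-\lambda'|\ge\varepsilon$ for all $\lambda'\in\Lambda\setminus\{\lambda\}$. Then $U$ is a coherent set of frequencies.
   Context: A measure is atomic if it has the form $\sum_{\lambda\in\Lambda}c_\lambda\delta_\lambda$ with $\Lambda$ countable, $\delta_\lambda$ the unit mass at $\lambda$; we write $\mu(\lambda)=c_\lambda$. A measure $\nu$ on $\mathbb{R}^d$ is translation bounded if $\sup_{t\in\mathbb{R}^d}|\nu|(B(t,1))<\infty$, where $|\nu|$ is the variation. The Fourier transform of a tempered distribution $f$ is defined by $\hat f(\varphi)=f(\hat\varphi)$, with $\hat\varphi(y)=\int\varphi(x)e^{-2\pi i\langle x,y\rangle}dx$. A uniformly discrete set $U\subset\mathbb{R}^d$ is a coherent set of frequencies if every limit, in the topology of uniform convergence on compact subsets of $\mathbb{R}^d$, of a sequence of finite sums $\sum c_\lambda e^{2\pi i\langle x,\lambda\rangle}$ with $\lambda\in U$, $c_\lambda\in\mathbb{C}$, is almost periodic in the sense of H. Bohr. *)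

theory Defs
  imports "HOL-Analysis.Analysis"
begin

text \<open>An atomic measure on the euclidean space 'a is given by its mass function c
  (c x = mu({x})), supported on a countable set.  Translation boundedness:
  the variation of the ball B(t,1) is bounded uniformly in t.\<close>
definition translation_bounded :: "('a::euclidean_space \<Rightarrow> complex) \<Rightarrow> bool" where
  "translation_bounded c \<longleftrightarrow>
     (\<exists>M. \<forall>t F. finite F \<longrightarrow> F \<subseteq> ball t 1 \<longrightarrow> (\<Sum>x\<in>F. norm (c x)) \<le> M)"

fun pderivs :: "'a::euclidean_space list \<Rightarrow> ('a \<Rightarrow> complex) \<Rightarrow> ('a \<Rightarrow> complex)" where
  "pderivs [] f = f"
| "pderivs (v # vs) f = (\<lambda>x. frechet_derivative (pderivs vs f) (at x) v)"

definition schwartz :: "('a::euclidean_space \<Rightarrow> complex) \<Rightarrow> bool" where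
  "schwartz \<phi> \<longleftrightarrow>
     (\<forall>vs. set vs \<subseteq> Basis \<longrightarrow> (\<forall>x. pderivs vs \<phi> differentiable at x)) \<and>
     (\<forall>vs (N::nat). set vs \<subseteq> Basis \<longrightarrow>
         bounded (range (\<lambda>x. (1 + norm x) ^ N * norm (pderivs vs \<phi> x))))"

definition fourier_transform :: "('a::euclidean_space \<Rightarrow> complex) \<Rightarrow> 'a \<Rightarrow> complex" where
  "fourier_transform \<phi> y = (\<integral>x. \<phi> x * cis (- 2 * pi * (x \<bullet> y)) \<partial>lborel)"

definition bohr_almost_periodic :: "('a::euclidean_space \<Rightarrow> complex) \<Rightarrow> bool" where
  "bohr_almost_periodic f \<longleftrightarrow> continuous_on UNIV f \<and>
     (\<forall>e>0. \<exists>L>0. \<forall>a. \<exists>\<tau>\<in>ball a L. \<forall>x. norm (f (x + \<tau>) - f x) \<le> e)"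

definition uniformly_discrete :: "'a::euclidean_space set \<Rightarrow> bool" where
  "uniformly_discrete U \<longleftrightarrow> (\<exists>\<delta>>0. \<forall>x\<in>U. \<forall>y\<in>U. x \<noteq> y \<longrightarrow> dist x y \<ge> \<delta>)"

definition exp_poly :: "'a::euclidean_space set \<Rightarrow> ('a \<Rightarrow> complex) \<Rightarrow> bool" where
  "exp_poly U g \<longleftrightarrow> (\<exists>F a. finite F \<and> F \<subseteq> U \<and>
      g = (\<lambda>x. \<Sum>w\<in>F. a w * cis (2 * pi * (x \<bullet> w))))"

definition coherent_frequencies :: "'a::euclidean_space set \<Rightarrow> bool" where
  "coherent_frequencies U \<longleftrightarrow> uniformly_discrete U \<and>
     (\<forall>P f. (\<forall>n. exp_poly U (P n)) \<and> (\<forall>K. compact K \<longrightarrow> uniform_limit K P f sequentially)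
        \<longrightarrow> bohr_almost_periodic f)"

end

theory Submission
  imports Defs "HOL-Probability.Probability"
begin

text \<open>Let P be a finite sum of a(w) exp(2 pi i x.w) over w in U. It suffices to bound sup |P| by a constant
  times the supremum of |P| over a fixed ball: then local uniform limits of such sums are uniform limits,
  hence almost periodic. Choose a kernel psi of integrable decay whose Fourier transform is
  supported in the ball of radius eps/2, and set Q(x) = kappa * (sum of c(w) a(w) exp(2 pi i x.w)). As the
  points of U are eps-isolated in Lambda, duality gives Q(x) as the sum of b(g) psi(g+x) P(g+x) over g.
  The decay of psi makes this sum essentially local, so sup |Q| is at most C sup |P| over a ball plus
  delta sup |P| with delta as small as desired. It remains to recover P from Q with a bound in the
  uniform norm, that is, to invert the function w -> kappa c(w) on U by a bounded multiplier. On U it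
  equals an absolutely convergent sum of characters of w bounded away from 0, and Wiener's local-to-global
  argument applies: cut U into finitely many pieces, by multipliers built from |sin|, on which finitely
  many characters are nearly constant, invert there by a geometric series, and glue.\<close>

section \<open>Power series with summable coefficients\<close>

text \<open>The Fourier transform of psi is a product of tents, so psi decays only quadratically in
  each coordinate and is not a Schwartz function: the duality does not apply to it directly. It is
  applied to modulated Gaussians, these are averaged over the tents, and the Gaussian damping is
  removed by a limit. Gaussians alone would not do, since their transforms reach all other points of
  Lambda. The function w -> kappa c(w) is bounded below on U only; the absolutely convergent sum
  extending it may vanish elsewhere. So a multiplier is sought that is the inverse on U, and U,
  which may be unbounded, is cut by the values of characters and not by position. The cutoffs must
  be multipliers as well, so they come from characters through power series with summable
  coefficients: that of sqrt (1 - y) at y = cos^2 yields |sin|, that of arcsin a local logarithm of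
  a character. The order of the choices matters: the norm of the inverse multiplier is found before
  the radius of the ball, so delta and then the radius can be chosen to absorb the term delta sup
  |P|.\<close>

lemma summable_coeffs_of_bounded_powser:
  fixes a :: "nat \<Rightarrow> real"
  assumes nonneg: "\<And>n. 0 \<le> a n"
    and sums: "\<And>x. 0 \<le> x \<Longrightarrow> x < 1 \<Longrightarrow> (\<lambda>n. a n * x ^ n) sums g x"
    and bdd: "\<And>x. 0 \<le> x \<Longrightarrow> x < 1 \<Longrightarrow> g x \<le> B"
  shows "summable a"
proof -
  \<comment> \<open>For x < 1 the partial sum at x is at most g x, as the omitted terms are
    nonnegative. Being a polynomial, it is continuous at 1.\<close>
  have "(\<Sum>n<N. a n) \<le> B" for N
  proof -
    have "((\<lambda>x. \<Sum>n<N. a n * x ^ n) \<longlongrightarrow> (\<Sum>n<N. a n * 1 ^ n)) (at_left (1::real))"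
      by (intro tendsto_intros)
    moreover have "\<forall>\<^sub>F x in at_left (1::real). (\<Sum>n<N. a n * x ^ n) \<le> B"
    proof -
      have "\<forall>\<^sub>F x in at_left (1::real). x \<in> {0<..<1}"
        by (rule eventually_at_leftI[of 0]) auto
      then show ?thesis
      proof eventually_elim
        case (elim x)
        then have s: "(\<lambda>n. a n * x ^ n) sums g x" using sums by auto
        have "(\<Sum>n<N. a n * x ^ n) \<le> suminf (\<lambda>n. a n * x ^ n)"
          using s elim by (intro sum_le_suminf) (auto simp: sums_iff nonneg)
        also have "\<dots> \<le> B" using s bdd[of x] elim by (auto simp: sums_iff)
        finally show ?case .
      qed
    qed
    ultimately show ?thesis
      by (simp add: tendsto_upperbound)
  qed
  then show ?thesis
    by (intro summableI_nonneg_bounded nonneg)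
qed

text \<open>Taylor coefficients of sqrt (1 - y) at 0.\<close>

definition sqrt_coeff :: "nat \<Rightarrow> real" where
  "sqrt_coeff n = ((1/2) gchoose n) * (-1) ^ n"

lemma sqrt_coeff_Suc_nonpos: "sqrt_coeff (Suc n) \<le> 0"
proof (induction n)
  case 0
  then show ?case by (simp add: sqrt_coeff_def)
next
  case (Suc n)
  have "sqrt_coeff (Suc (Suc n)) = sqrt_coeff (Suc n) * ((real n + 1/2) / (real n + 2))"
    by (simp add: sqrt_coeff_def gbinomial_Suc_rec field_simps)
  also have "\<dots> \<le> 0"
    using Suc.IH by (intro mult_nonpos_nonneg) auto
  finally show ?case .
qed

lemma sqrt_coeff_sums:
  assumes "\<bar>y\<bar> < 1"
  shows "(\<lambda>n. sqrt_coeff n * y ^ n) sums sqrt (1 - y)"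
  using sqrt_series[of "-y"] assms
  by (simp add: sqrt_coeff_def power_minus[of y] mult.assoc)

lemma sqrt_coeff_0 [simp]: "sqrt_coeff 0 = 1"
  by (simp add: sqrt_coeff_def)

text \<open>All coefficients but the first are nonpositive, so 1 - sqrt (1 - x) has nonnegative
  ones, and it is bounded by 1 on [0, 1).\<close>

lemma summable_abs_sqrt_coeff: "summable (\<lambda>n. \<bar>sqrt_coeff n\<bar>)"
proof -
  have "summable (\<lambda>n. if n = 0 then 0 else - sqrt_coeff n)"
  proof (rule summable_coeffs_of_bounded_powser[where g = "\<lambda>x. 1 - sqrt (1 - x)" and B = 1])
    show "0 \<le> (if n = 0 then 0 else - sqrt_coeff n)" for n
      using sqrt_coeff_Suc_nonpos[of "n - 1"] by auto
    show "(\<lambda>n. (if n = 0 then 0 else - sqrt_coeff n) * x ^ n) sums (1 - sqrt (1 - x))"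
      if "0 \<le> x" "x < 1" for x
    proof -
      have "(\<lambda>n. sqrt_coeff n * x ^ n) sums sqrt (1 - x)"
        using sqrt_coeff_sums that by simp
      then have "(\<lambda>n. (if n = 0 then 1 else 0) - sqrt_coeff n * x ^ n) sums (1 - sqrt (1 - x))"
        by (intro sums_diff) (auto intro: sums_single[of 0 "\<lambda>_. 1::real", simplified])
      then show ?thesis
        by (rule sums_cong[THEN iffD1, rotated]) auto
    qed
  qed auto
  then have "summable (\<lambda>n. (if n = 0 then 1 else 0) + (if n = 0 then 0 else - sqrt_coeff n))"
    by (intro summable_add) (auto intro: summable_finite[of "{0}"])
  moreover have "(if n = 0 then 1 else 0) + (if n = 0 then 0 else - sqrt_coeff n) = \<bar>sqrt_coeff n\<bar>" for n
    using sqrt_coeff_Suc_nonpos[of "n - 1"] by (cases n) auto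
  ultimately show ?thesis by simp
qed

text \<open>The point is the endpoint y = 1, because y will be the square of a cosine. Absolute
  summability makes the sum continuous on the closed interval, and the two sides agree on [0,
  1).\<close>

lemma sqrt_coeff_sums_closed:
  assumes "0 \<le> y" "y \<le> 1"
  shows "(\<lambda>n. sqrt_coeff n * y ^ n) sums sqrt (1 - y)"
proof -
  let ?f = "\<lambda>y. \<Sum>n. sqrt_coeff n * y ^ n"
  have bd: "norm (sqrt_coeff n * y ^ n) \<le> \<bar>sqrt_coeff n\<bar>" if "y \<in> {0..1}" for y n
    using that by (simp add: abs_mult power_abs power_le_one mult_left_le)
  have "uniform_limit {0..1} (\<lambda>k y. \<Sum>n<k. sqrt_coeff n * y ^ n) ?f sequentially"
    by (rule Weierstrass_m_test[OF bd summable_abs_sqrt_coeff])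
  then have cont: "continuous_on {0..1} ?f"
    by (rule uniform_limit_theorem[rotated]) (auto intro!: always_eventually continuous_intros)
  have eq: "?f y = sqrt (1 - y)" if "y \<in> {0..<1}" for y
    using sqrt_coeff_sums[of y] that by (auto simp: sums_iff)
  have "?f y = sqrt (1 - y)"
  proof (cases "y = 1")
    case True
    have "(?f \<longlongrightarrow> ?f 1) (at 1 within {0..1})"
      using cont unfolding continuous_on_def by (rule bspec) simp
    then have 1: "(?f \<longlongrightarrow> ?f 1) (at_left 1)"
      by (simp add: at_within_Icc_at_left)
    have 2: "\<forall>\<^sub>F x in at_left (1::real). sqrt (1 - x) = ?f x"
      by (rule eventually_at_leftI[of 0]) (auto simp: eq)
    have 3: "((\<lambda>x. sqrt (1 - x)) \<longlongrightarrow> sqrt (1 - 1)) (at_left (1::real))"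
      by (intro tendsto_intros)
    have "?f 1 = sqrt (1 - 1)"
      by (rule tendsto_unique[OF trivial_limit_at_left_real 1 Lim_transform_eventually[OF 3 2]])
    then show ?thesis using True by simp
  qed (use assms eq in auto)
  moreover have "summable (\<lambda>n. sqrt_coeff n * y ^ n)"
    using bd assms by (intro summable_comparison_test'[OF summable_abs_sqrt_coeff]) auto
  ultimately show ?thesis by (simp add: sums_iff)
qed

section \<open>The arcsine series\<close>

definition arcsin_coeff :: "nat \<Rightarrow> real" where
  "arcsin_coeff n = (if odd n then ((-1/2) gchoose (n div 2)) * (-1) ^ (n div 2) / n else 0)"

lemma arcsin_coeff_nonneg: "0 \<le> arcsin_coeff n"
proof -
  have "0 \<le> ((-1/2::real) gchoose k) * (-1) ^ k" for k
  proof (induction k)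
    case (Suc k)
    have "((-1/2::real) gchoose Suc k) * (-1) ^ Suc k
        = (((-1/2::real) gchoose k) * (-1) ^ k) * ((real k + 1/2) / (real k + 1))"
      by (simp add: gbinomial_Suc_rec field_simps)
    with Suc show ?case by (metis add_nonneg_nonneg divide_nonneg_nonneg mult_nonneg_nonneg of_nat_0_le_iff
        zero_le_one zero_le_numeral)
  qed auto
  then show ?thesis by (auto simp: arcsin_coeff_def)
qed

text \<open>The termwise derivative is the binomial series of 1 / sqrt (1 - x^2), so the sum and
  arcsin have the same derivative on (-1, 1) and the same value at 0.\<close>

lemma arcsin_coeff_sums:
  assumes "\<bar>x\<bar> < 1"
  shows "(\<lambda>n. arcsin_coeff n * x ^ n) sums arcsin x"
proof -
  have der: "(\<lambda>n. diffs arcsin_coeff n * x ^ n) sums (1 / sqrt (1 - x\<^sup>2))" if x: "\<bar>x\<bar> < 1" for x :: real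
  proof -
    have "\<bar>- (x\<^sup>2)\<bar> < 1" using x by (simp add: abs_square_less_1)
    then have "(\<lambda>k. ((-1/2) gchoose k) * (- (x\<^sup>2)) ^ k) sums ((1 + - (x\<^sup>2)) powr (-1/2))"
      by (rule gen_binomial_real)
    also have "(1 + - (x\<^sup>2)) powr (-1/2) = 1 / sqrt (1 - x\<^sup>2)"
      using \<open>\<bar>- (x\<^sup>2)\<bar> < 1\<close> by (simp add: powr_minus_divide powr_half_sqrt)
    also have "(\<lambda>k. ((-1/2) gchoose k) * (- (x\<^sup>2)) ^ k) = (\<lambda>k. diffs arcsin_coeff (2 * k) * x ^ (2 * k))"
      by (auto simp: fun_eq_iff diffs_def arcsin_coeff_def power_minus[of "x\<^sup>2"] power_mult)
    finally show ?thesis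
      by (subst (asm) sums_mono_reindex[of "\<lambda>k. 2 * k"])
         (auto simp: strict_mono_def diffs_def arcsin_coeff_def elim!: evenE)
  qed
  \<comment> \<open>From n = 1 on a term is dominated by n times its absolute value, and those
    bounds sum to |x| times the derivative series at |x|.\<close>
  have summ: "summable (\<lambda>n. arcsin_coeff n * x ^ n)" if x: "\<bar>x\<bar> < 1" for x :: real
  proof (rule summable_comparison_test'[where N = 1])
    let ?y = "\<bar>x\<bar>"
    have "summable (\<lambda>n. diffs arcsin_coeff n * ?y ^ n)"
      using der[of ?y] x by (auto simp: sums_iff)
    then have "summable (\<lambda>n. (diffs arcsin_coeff n * ?y ^ n) * ?y)"
      by (rule summable_mult2)
    then show "summable (\<lambda>n. n * arcsin_coeff n * ?y ^ n)"
      by (subst summable_Suc_iff[symmetric]) (simp add: diffs_def algebra_simps)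
    show "norm (arcsin_coeff n * x ^ n) \<le> n * arcsin_coeff n * ?y ^ n" if "n \<ge> 1" for n
    proof -
      have "1 * (arcsin_coeff n * ?y ^ n) \<le> n * (arcsin_coeff n * ?y ^ n)"
        using that by (intro mult_right_mono mult_nonneg_nonneg arcsin_coeff_nonneg) auto
      then show ?thesis by (simp add: abs_mult power_abs arcsin_coeff_nonneg)
    qed
  qed
  let ?F = "\<lambda>x. \<Sum>n. arcsin_coeff n * x ^ n"
  have "((\<lambda>x. ?F x - arcsin x) has_real_derivative 0) (at y)" if y: "\<bar>y\<bar> < 1" for y
  proof -
    obtain K where K: "\<bar>y\<bar> < K" "K < 1" using y dense by blast
    have "DERIV ?F y :> (\<Sum>n. diffs arcsin_coeff n * y ^ n)"
      by (rule termdiffs_strong[of arcsin_coeff K]) (use summ[of K] K in auto)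
    moreover have "DERIV arcsin y :> inverse (sqrt (1 - y\<^sup>2))"
      using y by (intro DERIV_arcsin) auto
    ultimately have "DERIV (\<lambda>x. ?F x - arcsin x) y :> (\<Sum>n. diffs arcsin_coeff n * y ^ n) - inverse (sqrt (1 - y\<^sup>2))"
      by (rule DERIV_diff)
    also have "(\<Sum>n. diffs arcsin_coeff n * y ^ n) - inverse (sqrt (1 - y\<^sup>2)) = 0"
      using der[OF y] by (simp add: sums_iff field_simps)
    finally show ?thesis .
  qed
  then have "\<exists>c. \<forall>y\<in>{-1<..<1}. ?F y - arcsin y = c"
    by (intro has_field_derivative_zero_constant) (auto intro: has_field_derivative_at_within)
  then obtain c where c: "\<And>y. \<bar>y\<bar> < 1 \<Longrightarrow> ?F y - arcsin y = c" 
    by (auto simp: abs_less_iff)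
  have "?F 0 = 0" by (subst suminf_finite[of "{0}"]) (auto simp: arcsin_coeff_def)
  then have "c = 0" using c[of 0] by simp
  then have "?F x = arcsin x" using c[OF assms] by simp
  then show ?thesis using summ[OF assms] by (simp add: sums_iff)
qed

text \<open>Nonnegative coefficients and a bounded sum on [0, 1). The total is the multiplier norm
  that the series produces from any multiplier of norm 1, whatever its frequency.\<close>

lemma summable_arcsin_coeff: "summable arcsin_coeff"
  by (rule summable_coeffs_of_bounded_powser[OF arcsin_coeff_nonneg arcsin_coeff_sums])
     (auto intro: arcsin_ubound)

section \<open>Multipliers of exponential polynomials\<close>

definition chr :: "'a::euclidean_space \<Rightarrow> 'a \<Rightarrow> complex" where
  "chr w x = cis (2 * pi * (x \<bullet> w))"

lemma norm_chr [simp]: "norm (chr w x) = 1"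
  by (simp add: chr_def)

lemma chr_add: "chr w (x + y) = chr w x * chr w y"
  by (simp add: chr_def cis_mult inner_add_left ring_distribs)

text \<open>Multipliers, with a bound on their norm, of the space of exponential polynomials under the
  uniform norm. The translation by y acts as the multiplier w \<mapsto> chr w y.\<close>
definition fmult :: "('a::euclidean_space \<Rightarrow> complex) \<Rightarrow> real \<Rightarrow> bool" where
  "fmult s C \<longleftrightarrow> (\<forall>F a B. finite F \<longrightarrow> (\<forall>x. norm (\<Sum>w\<in>F. a w * chr w x) \<le> B) \<longrightarrow>
     (\<forall>x. norm (\<Sum>w\<in>F. a w * s w * chr w x) \<le> C * B))"

lemma fmultD:
  assumes "fmult s C" "finite F" "\<And>x. norm (\<Sum>w\<in>F. a w * chr w x) \<le> B"
  shows "norm (\<Sum>w\<in>F. a w * s w * chr w x) \<le> C * B"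
  using assms unfolding fmult_def by blast

text \<open>Test the multiplier on the single exponential with frequency w.\<close>

lemma fmult_bound:
  assumes "fmult s C"
  shows "norm (s w) \<le> C"
  using fmultD[OF assms, of "{w}" "\<lambda>_. 1" 1 0] by (simp add: norm_mult)

lemma fmult_nonneg: "fmult s C \<Longrightarrow> 0 \<le> C"
  using fmult_bound norm_ge_zero order_trans by blast

lemma fmult_mono:
  fixes s :: "'a::euclidean_space \<Rightarrow> complex"
  assumes "fmult s C" "C \<le> D"
  shows "fmult s D"
  unfolding fmult_def
proof (intro allI impI)
  fix F :: "'a set" and a B x assume *: "finite F" "\<forall>x. norm (\<Sum>w\<in>F. a w * chr w x) \<le> B"
  have "0 \<le> B" using *(2) norm_ge_zero order_trans by blast
  have "norm (\<Sum>w\<in>F. a w * s w * chr w x) \<le> C * B"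
    using * by (intro fmultD[OF assms(1)]) auto
  also have "\<dots> \<le> D * B" using \<open>0 \<le> B\<close> assms by (intro mult_right_mono)
  finally show "norm (\<Sum>w\<in>F. a w * s w * chr w x) \<le> D * B" .
qed

lemma fmult_const: "fmult (\<lambda>_::'a::euclidean_space. c) (norm c)"
  unfolding fmult_def
proof (intro allI impI)
  fix F :: "'a set" and a B x assume *: "finite F" "\<forall>x. norm (\<Sum>w\<in>F. a w * chr w x) \<le> B"
  have "(\<Sum>w\<in>F. a w * c * chr w x) = c * (\<Sum>w\<in>F. a w * chr w x)"
    by (simp add: sum_distrib_left mult_ac)
  then show "norm (\<Sum>w\<in>F. a w * c * chr w x) \<le> norm c * B"
    using * by (simp add: norm_mult mult_left_mono)
qed

lemma fmult_chr: "fmult (\<lambda>w::'a::euclidean_space. chr w y) 1"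
  unfolding fmult_def
proof (intro allI impI)
  fix F :: "'a set" and a B x assume *: "finite F" "\<forall>x. norm (\<Sum>w\<in>F. a w * chr w x) \<le> B"
  have "(\<Sum>w\<in>F. a w * chr w y * chr w x) = (\<Sum>w\<in>F. a w * chr w (y + x))"
    by (simp add: chr_add mult_ac)
  then show "norm (\<Sum>w\<in>F. a w * chr w y * chr w x) \<le> 1 * B" using * by simp
qed

lemma fmult_add:
  fixes s :: "'a::euclidean_space \<Rightarrow> complex"
  assumes "fmult s C" "fmult t D"
  shows "fmult (\<lambda>w. s w + t w) (C + D)"
  unfolding fmult_def
proof (intro allI impI)
  fix F :: "'a set" and a B x assume *: "finite F" "\<forall>x. norm (\<Sum>w\<in>F. a w * chr w x) \<le> B"
  have "(\<Sum>w\<in>F. a w * (s w + t w) * chr w x)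
      = (\<Sum>w\<in>F. a w * s w * chr w x) + (\<Sum>w\<in>F. a w * t w * chr w x)"
    by (simp add: sum.distrib ring_distribs)
  also have "norm \<dots> \<le> C * B + D * B"
    using * by (intro norm_triangle_mono fmultD[OF assms(1)] fmultD[OF assms(2)]) auto
  finally show "norm (\<Sum>w\<in>F. a w * (s w + t w) * chr w x) \<le> (C + D) * B"
    by (simp add: ring_distribs)
qed

lemma fmult_mult:
  fixes s :: "'a::euclidean_space \<Rightarrow> complex"
  assumes "fmult s C" "fmult t D"
  shows "fmult (\<lambda>w. s w * t w) (C * D)"
  unfolding fmult_def
proof (intro allI impI)
  fix F :: "'a set" and a B x assume *: "finite F" "\<forall>x. norm (\<Sum>w\<in>F. a w * chr w x) \<le> B"
  have "norm (\<Sum>w\<in>F. (a w * t w) * s w * chr w x) \<le> C * (D * B)"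
    using * by (intro fmultD[OF assms(1)] fmultD[OF assms(2)]) auto
  then show "norm (\<Sum>w\<in>F. a w * (s w * t w) * chr w x) \<le> C * D * B"
    by (simp add: mult_ac)
qed

lemma fmult_cmult: "fmult s C \<Longrightarrow> fmult (\<lambda>w. c * s w) (norm c * C)"
  by (intro fmult_mult fmult_const)

lemma fmult_uminus: "fmult s C \<Longrightarrow> fmult (\<lambda>w. - s w) C"
  using fmult_cmult[of s C "-1"] by simp

lemma fmult_diff: "fmult s C \<Longrightarrow> fmult t D \<Longrightarrow> fmult (\<lambda>w. s w - t w) (C + D)"
  using fmult_add[OF _ fmult_uminus] by (simp add: algebra_simps)

lemma fmult_power: "fmult s C \<Longrightarrow> fmult (\<lambda>w. s w ^ n) (C ^ n)"
  by (induction n) (use fmult_const[of 1] in \<open>auto intro: fmult_mult\<close>)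

lemma fmult_sum:
  assumes "\<And>i. i \<in> I \<Longrightarrow> fmult (s i) (C i)"
  shows "fmult (\<lambda>w. \<Sum>i\<in>I. s i w) (\<Sum>i\<in>I. C i)"
  using assms
proof (induction I rule: infinite_finite_induct)
  case (insert i I)
  then show ?case by (auto intro!: fmult_add)
qed (use fmult_const[of 0] in auto)

text \<open>Pointwise convergence suffices because multipliers are tested on finite sums
  only.\<close>

lemma fmult_limit:
  fixes t :: "'a::euclidean_space \<Rightarrow> complex"
  assumes "G \<noteq> bot" "\<forall>\<^sub>F n in G. fmult (s n) C" "\<And>w. ((\<lambda>n. s n w) \<longlongrightarrow> t w) G"
  shows "fmult t C"
  unfolding fmult_def
proof (intro allI impI)
  fix F :: "'a set" and a B x assume *: "finite F" "\<forall>x. norm (\<Sum>w\<in>F. a w * chr w x) \<le> B"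
  have "((\<lambda>n. norm (\<Sum>w\<in>F. a w * s n w * chr w x)) \<longlongrightarrow> norm (\<Sum>w\<in>F. a w * t w * chr w x)) G"
    by (intro tendsto_intros assms)
  moreover have "\<forall>\<^sub>F n in G. norm (\<Sum>w\<in>F. a w * s n w * chr w x) \<le> C * B"
    using assms(2) by eventually_elim (use * in \<open>auto intro: fmultD\<close>)
  ultimately show "norm (\<Sum>w\<in>F. a w * t w * chr w x) \<le> C * B"
    using assms(1) by (rule tendsto_upperbound)
qed

lemma fmult_suminf:
  assumes "\<And>n. fmult (s n) (C n)" "summable C"
  shows "fmult (\<lambda>w. \<Sum>n. s n w) (suminf C)"
proof (rule fmult_limit[of sequentially "\<lambda>N w. \<Sum>n<N. s n w"])
  have "fmult (\<lambda>w. \<Sum>n<N. s n w) (suminf C)" for N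
    using assms by (intro fmult_mono[OF fmult_sum sum_le_suminf]) (auto intro: fmult_nonneg)
  then show "\<forall>\<^sub>F N in sequentially. fmult (\<lambda>w. \<Sum>n<N. s n w) (suminf C)" by simp
  fix w
  have "summable (\<lambda>n. s n w)"
    by (rule summable_comparison_test'[OF assms(2)]) (use assms in \<open>auto intro: fmult_bound\<close>)
  then show "(\<lambda>N. \<Sum>n<N. s n w) \<longlonglongrightarrow> (\<Sum>n. s n w)"
    by (rule summable_LIMSEQ)
qed simp

text \<open>Each character has multiplier norm 1, so the l1 norm of the coefficients bounds the sum.
  This is what makes the tail of such a sum small as a multiplier, not just in supremum.\<close>

lemma fmult_infsum_chr:
  assumes "(\<lambda>g. norm (\<beta> g)) summable_on \<Gamma>"
  shows "fmult (\<lambda>w. \<Sum>\<^sub>\<infinity>g\<in>\<Gamma>. \<beta> g * chr w g) (\<Sum>\<^sub>\<infinity>g\<in>\<Gamma>. norm (\<beta> g))"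
proof (rule fmult_limit[of "finite_subsets_at_top \<Gamma>" "\<lambda>X w. \<Sum>g\<in>X. \<beta> g * chr w g"])
  have "fmult (\<lambda>w. \<Sum>g\<in>X. \<beta> g * chr w g) (\<Sum>\<^sub>\<infinity>g\<in>\<Gamma>. norm (\<beta> g))" if "finite X" "X \<subseteq> \<Gamma>" for X
  proof (rule fmult_mono)
    show "fmult (\<lambda>w. \<Sum>g\<in>X. \<beta> g * chr w g) (\<Sum>g\<in>X. norm (\<beta> g) * 1)"
      by (intro fmult_sum fmult_cmult fmult_chr)
    show "(\<Sum>g\<in>X. norm (\<beta> g) * 1) \<le> (\<Sum>\<^sub>\<infinity>g\<in>\<Gamma>. norm (\<beta> g))"
      using finite_sum_le_infsum[OF assms that] by simp
  qed
  then show "\<forall>\<^sub>F X in finite_subsets_at_top \<Gamma>. fmult (\<lambda>w. \<Sum>g\<in>X. \<beta> g * chr w g) (\<Sum>\<^sub>\<infinity>g\<in>\<Gamma>. norm (\<beta> g))"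
    by (auto intro: eventually_finite_subsets_at_top_weakI)
  fix w
  have "(\<lambda>g. \<beta> g * chr w g) summable_on \<Gamma>"
    by (rule abs_summable_summable) (use assms in \<open>simp add: norm_mult\<close>)
  then show "((\<lambda>X. \<Sum>g\<in>X. \<beta> g * chr w g) \<longlongrightarrow> (\<Sum>\<^sub>\<infinity>g\<in>\<Gamma>. \<beta> g * chr w g)) (finite_subsets_at_top \<Gamma>)"
    by (rule has_sum_infsum[unfolded has_sum_def])
qed simp

text \<open>The coefficients are weighted by powers of the multiplier norm r and not of the supremum
  of s. Sines and cosines have r = 1, so their series must converge absolutely at 1.\<close>

lemma fmult_powser:
  assumes "fmult s r" "summable (\<lambda>n. norm (a n) * r ^ n)"
  shows "fmult (\<lambda>w. \<Sum>n. a n * s w ^ n) (\<Sum>n. norm (a n) * r ^ n)"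
  by (intro fmult_suminf fmult_cmult fmult_power assms)

text \<open>Euler's formula: two characters with coefficients of modulus 1/2, hence the bound
  1.\<close>

lemma fmult_sin: "fmult (\<lambda>w. of_real (sin (v \<bullet> w + r))) 1"
proof -
  let ?y = "(1 / (2 * pi)) *\<^sub>R v"
  have "fmult (\<lambda>w. (- \<i> / 2) * cis r * chr w ?y + (\<i> / 2) * cis (-r) * chr w (- ?y))
     (norm ((- \<i> / 2) * cis r) * 1 + norm ((\<i> / 2) * cis (-r)) * 1)"
    by (intro fmult_add fmult_cmult fmult_chr)
  also have "(\<lambda>w. (- \<i> / 2) * cis r * chr w ?y + (\<i> / 2) * cis (-r) * chr w (- ?y))
     = (\<lambda>w. of_real (sin (v \<bullet> w + r)))"
  proof
    fix w
    have 1: "cis r * chr w ?y = cis (v \<bullet> w + r)"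
      by (simp add: chr_def cis_mult add.commute)
    have 2: "cis (- r) * chr w (- ?y) = cis (- (v \<bullet> w + r))"
      by (simp add: chr_def cis_mult add.commute)
    have "(- \<i> / 2) * cis r * chr w ?y + (\<i> / 2) * cis (-r) * chr w (- ?y)
        = (- \<i> / 2) * cis (v \<bullet> w + r) + (\<i> / 2) * cis (- (v \<bullet> w + r))"
      by (simp only: mult.assoc 1 2)
    also have "\<dots> = of_real (sin (v \<bullet> w + r))"
      by (simp add: complex_eq_iff del: minus_add_distrib)
    finally show "(- \<i> / 2) * cis r * chr w ?y + (\<i> / 2) * cis (-r) * chr w (- ?y)
        = of_real (sin (v \<bullet> w + r))" .
  qed
  finally show ?thesis by (simp add: norm_mult)
qed

lemma fmult_cos: "fmult (\<lambda>w. of_real (cos (v \<bullet> w + r))) 1"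
  using fmult_sin[of v "r + pi/2"] by (simp add: sin_add cos_add)

text \<open>|sin| is the square root of 1 - cos^2, expanded in powers of cos^2; the expansion stays
  valid where cos^2 = 1.\<close>

lemma fmult_abs_sin: "\<exists>C. fmult (\<lambda>w. of_real \<bar>sin (v \<bullet> w + r)\<bar>) C"
proof -
  have "fmult (\<lambda>w. (of_real (cos (v \<bullet> w + r)) :: complex)\<^sup>2) (1\<^sup>2)"
    by (intro fmult_power fmult_cos)
  then have "fmult (\<lambda>w. \<Sum>n. of_real (sqrt_coeff n) * ((of_real (cos (v \<bullet> w + r)))\<^sup>2) ^ n)
      (\<Sum>n. norm (of_real (sqrt_coeff n) :: complex) * (1\<^sup>2) ^ n)"
    by (rule fmult_powser) (simp add: summable_abs_sqrt_coeff)
  also have "(\<lambda>w. \<Sum>n. complex_of_real (sqrt_coeff n) * ((of_real (cos (v \<bullet> w + r)))\<^sup>2) ^ n)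
     = (\<lambda>w. of_real \<bar>sin (v \<bullet> w + r)\<bar>)"
  proof
    fix w
    let ?c = "cos (v \<bullet> w + r)"
    have "(\<lambda>n. sqrt_coeff n * (?c\<^sup>2) ^ n) sums sqrt (1 - ?c\<^sup>2)"
      by (rule sqrt_coeff_sums_closed) (auto simp: abs_square_le_1)
    also have "sqrt (1 - ?c\<^sup>2) = \<bar>sin (v \<bullet> w + r)\<bar>"
      by (simp flip: sin_squared_eq)
    finally have "(\<lambda>n. complex_of_real (sqrt_coeff n * (?c\<^sup>2) ^ n)) sums of_real \<bar>sin (v \<bullet> w + r)\<bar>"
      by (simp only: sums_of_real_iff)
    then show "(\<Sum>n. complex_of_real (sqrt_coeff n) * ((of_real ?c)\<^sup>2) ^ n) = of_real \<bar>sin (v \<bullet> w + r)\<bar>"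
      by (simp add: sums_iff)
  qed
  finally show ?thesis by blast
qed

text \<open>The series gives a multiplier at every w; its value is identified only inside the
  interval of convergence, which covers the points near which it will be used.\<close>

lemma fmult_arcsin_sin:
  obtains A where "fmult A (suminf arcsin_coeff)"
    "\<And>w. \<bar>sin (v \<bullet> w + r)\<bar> < 1 \<Longrightarrow> A w = of_real (arcsin (sin (v \<bullet> w + r)))"
proof
  have "fmult (\<lambda>w. \<Sum>n. of_real (arcsin_coeff n) * (of_real (sin (v \<bullet> w + r))) ^ n)
      (\<Sum>n. norm (of_real (arcsin_coeff n) :: complex) * 1 ^ n)"
    by (rule fmult_powser[OF fmult_sin])
       (simp add: arcsin_coeff_nonneg summable_arcsin_coeff)
  then show "fmult (\<lambda>w. \<Sum>n. of_real (arcsin_coeff n) * (of_real (sin (v \<bullet> w + r))) ^ n) (suminf arcsin_coeff)"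
    by (simp add: arcsin_coeff_nonneg)
  fix w assume "\<bar>sin (v \<bullet> w + r)\<bar> < 1"
  then have "(\<lambda>n. complex_of_real (arcsin_coeff n * sin (v \<bullet> w + r) ^ n)) sums of_real (arcsin (sin (v \<bullet> w + r)))"
    by (simp only: sums_of_real_iff arcsin_coeff_sums)
  then show "(\<Sum>n. of_real (arcsin_coeff n) * (of_real (sin (v \<bullet> w + r))) ^ n) = complex_of_real (arcsin (sin (v \<bullet> w + r)))"
    by (simp add: sums_iff)
qed

text \<open>Removing the constant term leaves a bound that tends to 0 with r.\<close>

lemma fmult_exp_minus_one:
  assumes "fmult s r"
  shows "fmult (\<lambda>w. exp (s w) - 1) (exp r - 1)"
proof -
  have *: "(\<lambda>n. (if n = 0 then 0 else inverse (fact n)) * z ^ n) sums (exp z - 1)"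
    for z :: "'b::{banach,real_normed_field}"
  proof -
    have "(\<lambda>n. inverse (fact n) * z ^ n - (if n = 0 then 1 else 0)) sums (exp z - 1)"
      using exp_converges[of z] 
      by (intro sums_diff) (auto simp: scaleR_conv_of_real intro: sums_single[of 0 "\<lambda>_. 1", simplified])
    then show ?thesis by (rule sums_cong[THEN iffD1, rotated]) auto
  qed
  have n: "norm (if n = 0 then 0 else inverse (fact n) :: complex) = (if n = 0 then 0 else inverse (fact n))" for n
    by (simp add: norm_inverse)
  have "fmult (\<lambda>w. \<Sum>n. (if n = 0 then 0 else inverse (fact n)) * s w ^ n) (\<Sum>n. norm (if n = 0 then 0 else inverse (fact n) :: complex) * r ^ n)"
    by (rule fmult_powser[OF assms]) (use *[of r] in \<open>simp add: sums_iff n\<close>)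
  then show ?thesis
    using *[of r] *[of "s w" for w] by (simp add: sums_iff n)
qed

lemma fmult_inverse_one_minus:
  assumes "fmult s r" "r < 1"
  shows "fmult (\<lambda>w. inverse (1 - s w)) (1 / (1 - r))"
proof -
  have "0 \<le> r" using assms fmult_nonneg by blast
  then have r: "(\<lambda>n. r ^ n) sums (1 / (1 - r))" using assms by (intro geometric_sums) auto
  have "fmult (\<lambda>w. \<Sum>n. s w ^ n) (\<Sum>n. r ^ n)"
    by (intro fmult_suminf fmult_power assms) (use r in \<open>simp add: sums_iff\<close>)
  moreover have "(\<Sum>n. s w ^ n) = inverse (1 - s w)" for w
    using geometric_sums[of "s w"] fmult_bound[OF assms(1), of w] assms(2)
    by (simp add: sums_iff field_simps)
  ultimately show ?thesis using r by (simp add: sums_iff)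
qed

section \<open>A Wiener lemma for multipliers\<close>

text \<open>Off X the values of s are free. This freedom lets f vanish there and allows local
  inverses to be glued.\<close>

definition invertible_on :: "('a::euclidean_space \<Rightarrow> complex) \<Rightarrow> 'a set \<Rightarrow> bool" where
  "invertible_on f X \<longleftrightarrow> (\<exists>s C. fmult s C \<and> (\<forall>w\<in>X. s w * f w = 1))"

text \<open>The inverse is the interpolation \<open>\<tau> * s1 + (1 - \<tau>) * s2\<close>: where
  either of \<open>s1\<close> and \<open>s2\<close> may be wrong, its weight is 0.\<close>

lemma invertible_on_glue:
  assumes "fmult \<tau> C"
    and "invertible_on f {w\<in>X. \<tau> w \<noteq> 0}" "invertible_on f {w\<in>X. \<tau> w \<noteq> 1}"
  shows "invertible_on f X"
proof -
  obtain s1 C1 where s1: "fmult s1 C1" "\<And>w. w \<in> X \<Longrightarrow> \<tau> w \<noteq> 0 \<Longrightarrow> s1 w * f w = 1"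
    using assms(2) by (auto simp: invertible_on_def)
  obtain s2 C2 where s2: "fmult s2 C2" "\<And>w. w \<in> X \<Longrightarrow> \<tau> w \<noteq> 1 \<Longrightarrow> s2 w * f w = 1"
    using assms(3) by (auto simp: invertible_on_def)
  have "fmult (\<lambda>w. \<tau> w * s1 w + (1 - \<tau> w) * s2 w) (C * C1 + (norm (1::complex) + C) * C2)"
    by (intro fmult_add fmult_mult fmult_diff fmult_const assms s1 s2)
  moreover have "(\<tau> w * s1 w + (1 - \<tau> w) * s2 w) * f w = 1" if "w \<in> X" for w
  proof -
    have a: "\<tau> w * (s1 w * f w) = \<tau> w" using s1(2)[OF that] by (cases "\<tau> w = 0") auto
    have b: "(1 - \<tau> w) * (s2 w * f w) = 1 - \<tau> w" using s2(2)[OF that] by (cases "\<tau> w = 1") auto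
    have "(\<tau> w * s1 w + (1 - \<tau> w) * s2 w) * f w = \<tau> w * (s1 w * f w) + (1 - \<tau> w) * (s2 w * f w)"
      by (simp add: algebra_simps)
    then show ?thesis unfolding a b by simp
  qed
  ultimately show ?thesis unfolding invertible_on_def by blast
qed

lemma invertible_on_subset: "invertible_on f Y \<Longrightarrow> X \<subseteq> Y \<Longrightarrow> invertible_on f X"
  unfolding invertible_on_def by blast

lemma invertible_on_empty: "invertible_on f {}"
  using fmult_const[of 0] by (auto simp: invertible_on_def)

text \<open>In place of a partition of unity, some cutoff must equal 1 at each point. Gluing with
  one cutoff leaves the set where it differs from 1, and there one of the remaining cutoffs equals
  1.\<close>

lemma invertible_on_glue_finite:
  assumes "finite I" "\<And>i. i \<in> I \<Longrightarrow> \<exists>C. fmult (\<tau> i) C"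
    and "\<And>i. i \<in> I \<Longrightarrow> invertible_on f {w\<in>X. \<tau> i w \<noteq> 0}"
    and "\<And>w. w \<in> X \<Longrightarrow> \<exists>i\<in>I. \<tau> i w = 1"
  shows "invertible_on f X"
  using assms
proof (induction I arbitrary: X rule: finite_induct)
  case empty
  then have "X = {}" by auto
  then show ?case by (simp add: invertible_on_empty)
next
  case (insert i I)
  from insert.prems(1)[of i] obtain C where C: "fmult (\<tau> i) C" by auto
  show ?case
  proof (rule invertible_on_glue[OF C])
    show "invertible_on f {w \<in> X. \<tau> i w \<noteq> 0}" using insert.prems by auto
    show "invertible_on f {w \<in> X. \<tau> i w \<noteq> 1}"
    proof (rule insert.IH)
      fix j assume "j \<in> I"
      then show "invertible_on f {w \<in> {w \<in> X. \<tau> i w \<noteq> 1}. \<tau> j w \<noteq> 0}"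
        using insert.prems(2)[of j] by (auto elim: invertible_on_subset)
    qed (use insert.prems in auto)
  qed
qed

text \<open>A trapezoidal function of the cosine; it is a multiplier since a difference of two cosines is
  a product of two sines, whose absolute values are multipliers.\<close>
lemma fmult_plateau:
  assumes "cos p < cos q"
  obtains \<tau> C where "fmult \<tau> C"
    "\<And>w. cos (v \<bullet> w + r) \<le> cos p \<Longrightarrow> \<tau> w = 0" "\<And>w. cos q \<le> cos (v \<bullet> w + r) \<Longrightarrow> \<tau> w = 1"
proof -
  have *: "\<exists>C. fmult (\<lambda>w. of_real \<bar>cos (v \<bullet> w + r) - cos p\<bar>) C" for p
  proof -
    obtain C where C: "fmult (\<lambda>w. of_real \<bar>sin ((v /\<^sub>R 2) \<bullet> w + (r + p) / 2)\<bar>) C"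
      using fmult_abs_sin by blast
    obtain D where D: "fmult (\<lambda>w. of_real \<bar>sin ((v /\<^sub>R 2) \<bullet> w + (r - p) / 2)\<bar>) D"
      using fmult_abs_sin by blast
    have "fmult (\<lambda>w. 2 * (of_real \<bar>sin ((v /\<^sub>R 2) \<bullet> w + (r + p) / 2)\<bar> * of_real \<bar>sin ((v /\<^sub>R 2) \<bullet> w + (r - p) / 2)\<bar>))
      (norm (2::complex) * (C * D))"
      by (intro fmult_cmult fmult_mult C D)
    also have "(\<lambda>w. 2 * (complex_of_real \<bar>sin ((v /\<^sub>R 2) \<bullet> w + (r + p) / 2)\<bar> * of_real \<bar>sin ((v /\<^sub>R 2) \<bullet> w + (r - p) / 2)\<bar>))
      = (\<lambda>w. of_real \<bar>cos (v \<bullet> w + r) - cos p\<bar>)"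
    proof
      fix w
      have "cos (v \<bullet> w + r) - cos p = 2 * sin ((v \<bullet> w + r + p) / 2) * sin ((p - (v \<bullet> w + r)) / 2)"
        by (rule cos_diff_cos)
      also have "(v \<bullet> w + r + p) / 2 = (v /\<^sub>R 2) \<bullet> w + (r + p) / 2" by (simp add: field_simps)
      also have "(p - (v \<bullet> w + r)) / 2 = - ((v /\<^sub>R 2) \<bullet> w + (r - p) / 2)" by (simp add: field_simps)
      finally have "\<bar>cos (v \<bullet> w + r) - cos p\<bar> =
          2 * (\<bar>sin ((v /\<^sub>R 2) \<bullet> w + (r + p) / 2)\<bar> * \<bar>sin ((v /\<^sub>R 2) \<bullet> w + (r - p) / 2)\<bar>)"
        by (simp only: sin_minus abs_mult abs_minus_cancel abs_numeral mult.assoc)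
      then show "2 * (complex_of_real \<bar>sin ((v /\<^sub>R 2) \<bullet> w + (r + p) / 2)\<bar> * of_real \<bar>sin ((v /\<^sub>R 2) \<bullet> w + (r - p) / 2)\<bar>)
        = of_real \<bar>cos (v \<bullet> w + r) - cos p\<bar>"
        by (simp only: of_real_mult of_real_numeral)
    qed
    finally show ?thesis by blast
  qed
  obtain C where C: "fmult (\<lambda>w. of_real \<bar>cos (v \<bullet> w + r) - cos p\<bar>) C" using * by blast
  obtain D where D: "fmult (\<lambda>w. of_real \<bar>cos (v \<bullet> w + r) - cos q\<bar>) D" using * by blast
  let ?d = "complex_of_real (cos q - cos p)"
  \<comment> \<open>With x for the cosine, |x - cos p| - |x - cos q| is the constant -(cos q - cos
    p) left of cos p and +(cos q - cos p) right of cos q; shifting and scaling sends these to 0 and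
    1.\<close>
  let ?\<tau> = "\<lambda>w. (1 / (2 * ?d)) * (of_real \<bar>cos (v \<bullet> w + r) - cos p\<bar> - of_real \<bar>cos (v \<bullet> w + r) - cos q\<bar> + ?d)"
  have "fmult ?\<tau> (norm (1 / (2 * ?d)) * ((C + D) + norm ?d))"
    by (intro fmult_cmult fmult_add fmult_diff C D fmult_const)
  moreover have "?\<tau> w = 0" if "cos (v \<bullet> w + r) \<le> cos p" for w
    using that assms by simp
  moreover have "?\<tau> w = 1" if "cos q \<le> cos (v \<bullet> w + r)" for w
  proof -
    let ?x = "cos (v \<bullet> w + r)"
    have "\<bar>?x - cos p\<bar> - \<bar>?x - cos q\<bar> + (cos q - cos p) = 2 * (cos q - cos p)"
      using that assms by (simp add: abs_of_nonneg)
    then have "complex_of_real (\<bar>?x - cos p\<bar> - \<bar>?x - cos q\<bar> + (cos q - cos p)) = of_real (2 * (cos q - cos p))"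
      by (rule arg_cong)
    then have "of_real \<bar>?x - cos p\<bar> - of_real \<bar>?x - cos q\<bar> + ?d = 2 * ?d"
      by (simp only: of_real_diff of_real_add of_real_mult of_real_numeral)
    moreover have "?d \<noteq> 0" using assms by (simp del: of_real_diff)
    ultimately show ?thesis by (simp only:) simp
  qed
  ultimately show ?thesis using that by blast
qed

text \<open>Reduce to the distance from the nearest integer, which lies in [0, 1/2]; there the
  cosine of 2 pi times it is decreasing.\<close>

lemma cos_near_one:
  assumes "cos (2 * pi * \<delta>) < cos (2 * pi * u)" "0 \<le> \<delta>" "\<delta> \<le> 1/2"
  obtains k :: int where "\<bar>u - k\<bar> < \<delta>"
proof
  define v where "v = \<bar>u - round u\<bar>"
  have "v \<le> 1/2" unfolding v_def by (metis abs_minus_commute of_int_round_abs_le)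
  have "cos (2 * pi * u) = cos (2 * pi * (u - round u))"
    by (simp add: right_diff_distrib cos_diff sin_int_2pin cos_int_2pin mult.assoc[symmetric])
  also have "\<dots> = cos (2 * pi * v)"
    using cos_abs_real[of "2 * pi * (u - round u)"] by (simp only: v_def abs_mult) simp
  finally have "cos (2 * pi * \<delta>) < cos (2 * pi * v)" using assms by simp
  moreover have "v \<ge> 0" by (simp add: v_def)
  ultimately have "2 * pi * v < 2 * pi * \<delta>"
    using assms \<open>v \<le> 1/2\<close> by (subst (asm) cos_mono_less_eq) (auto simp: field_simps)
  then have "v < \<delta>" by simp
  then show "\<bar>u - real_of_int (round u)\<bar> < \<delta>" by (simp add: v_def)
qed

text \<open>Near a point of the unit circle a character differs from a constant by a multiplier of small
  norm: if u is close to an integer then 2 pi u is congruent to arcsin (sin (2 pi L u)) / L modulo 2 pi,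
  and the latter has norm O(1/L).\<close>
lemma fmult_local_chr:
  assumes "\<eta> > 0"
  obtains \<delta> where "\<delta> > 0" "\<delta> \<le> 1/2"
    "\<And>y a. \<exists>v. fmult v \<eta> \<and> (\<forall>w. cos (2 * pi * \<delta>) < cos (2 * pi * (y \<bullet> w - a)) \<longrightarrow>
        chr w y = cis (2 * pi * a) * (1 + v w))"
proof -
  define K where "K = suminf arcsin_coeff"
  have "((\<lambda>n. exp (K * inverse (real (Suc n))) - 1) \<longlongrightarrow> exp (K * 0) - 1) sequentially"
    by (intro tendsto_intros LIMSEQ_inverse_real_of_nat)
  then have "\<forall>\<^sub>F n in sequentially. exp (K * inverse (real (Suc n))) - 1 < \<eta>"
    using assms by (intro order_tendstoD) auto
  then obtain n where n: "exp (K * inverse (real (Suc n))) - 1 < \<eta>"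
    by (auto simp: eventually_sequentially)
  \<comment> \<open>The norm K of the arcsine multiplier does not depend on the frequency, so
    dividing by L makes the logarithm as small as desired: L satisfies exp (K / L) - 1 <
    \<open>\<eta>\<close>.\<close>
  define L where "L = Suc n"
  have L: "L > 0" by (simp add: L_def)
  \<comment> \<open>If u is within \<open>\<delta>\<close> of 0 then |2 pi L u| < pi / 2, the range
    on which arcsin inverts sin.\<close>
  define \<delta> where "\<delta> = 1 / (4 * real L)"
  show ?thesis
  proof (rule that)
    show \<delta>: "\<delta> > 0" "\<delta> \<le> 1/2" using L by (auto simp: \<delta>_def field_simps)
    fix y :: 'a and a :: real
    obtain A where A: "fmult A K"
      "\<And>w. \<bar>sin ((2 * pi * L) *\<^sub>R y \<bullet> w + (- 2 * pi * L * a))\<bar> < 1 \<Longrightarrow>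
          A w = of_real (arcsin (sin ((2 * pi * L) *\<^sub>R y \<bullet> w + (- 2 * pi * L * a))))"
      using fmult_arcsin_sin[of "(2 * pi * L) *\<^sub>R y" "- 2 * pi * L * a"] unfolding K_def by metis
    \<comment> \<open>Where the cosine condition holds, \<open>A w\<close> is 2 pi L u, with u the
      signed distance of \<open>y \<bullet> w - a\<close> from a nearby integer; so
      \<open>1 + v w\<close> is \<open>cis (2 * pi * u)\<close>.\<close>
    define v where "v w = exp ((\<i> / of_nat L) * A w) - 1" for w
    have nL: "norm (\<i> / of_nat L) = 1 / real L" by (simp add: norm_divide)
    have "fmult v (exp (norm (\<i> / of_nat L) * K) - 1)"
      unfolding v_def by (intro fmult_exp_minus_one fmult_cmult A)
    then have "fmult v \<eta>"
    proof (rule fmult_mono)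
      show "exp (norm (\<i> / of_nat L) * K) - 1 \<le> \<eta>"
        unfolding nL using n by (simp add: L_def divide_inverse mult.commute)
    qed
    moreover have "chr w y = cis (2 * pi * a) * (1 + v w)"
      if w: "cos (2 * pi * \<delta>) < cos (2 * pi * (y \<bullet> w - a))" for w
    proof -
      obtain k :: int where k: "\<bar>y \<bullet> w - a - k\<bar> < \<delta>"
        using cos_near_one[OF w] \<delta> by auto
      define u where "u = y \<bullet> w - a - k"
      define t where "t = 2 * pi * L * u"
      have t: "\<bar>t\<bar> < pi / 2"
      proof -
        have "2 * pi * L * \<bar>u\<bar> < 2 * pi * L * \<delta>"
          using k L by (intro mult_strict_left_mono) (auto simp: u_def)
        also have "\<dots> = pi / 2" using L by (simp add: \<delta>_def field_simps)
        finally show ?thesis using L by (simp add: t_def abs_mult)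
      qed
      \<comment> \<open>L is an integer, so the integer part k shifts the argument by a multiple of
        2 pi.\<close>
      have arg: "(2 * pi * L) *\<^sub>R y \<bullet> w + (- 2 * pi * L * a) = t + 2 * pi * of_int (int L * k)"
        by (simp add: t_def u_def algebra_simps)
      have sin: "sin ((2 * pi * L) *\<^sub>R y \<bullet> w + (- 2 * pi * L * a)) = sin t"
        unfolding arg by (simp only: sin_add sin_int_2pin cos_int_2pin mult_1_right mult_zero_right add_0_right)
      have "\<bar>sin t\<bar> < 1"
        using t sin_monotone_2pi[of t "pi/2"] sin_monotone_2pi[of "-pi/2" t] by (auto simp: abs_less_iff)
      then have "A w = of_real (arcsin (sin t))" using A(2)[of w] sin by simp
      also have "arcsin (sin t) = t" using t by (intro arcsin_sin) auto
      finally have "1 + v w = exp (\<i> * of_real (2 * pi * u))"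
        using L by (simp add: v_def t_def field_simps)
      then have "1 + v w = cis (2 * pi * u)" by (simp add: cis_conv_exp)
      moreover have "chr w y = cis (2 * pi * a) * cis (2 * pi * u)"
      proof -
        have "chr w y = cis (2 * pi * (a + u) + 2 * pi * of_int k)"
          unfolding chr_def u_def by (simp add: algebra_simps)
        also have "\<dots> = cis (2 * pi * (a + u))"
          by (simp only: cis_mult[symmetric] cis_multiple_2pi Ints_of_int) simp
        finally show ?thesis by (simp add: cis_mult ring_distribs)
      qed
      ultimately show ?thesis by simp
    qed
    ultimately show "\<exists>v. fmult v \<eta> \<and> (\<forall>w. cos (2 * pi * \<delta>) < cos (2 * pi * (y \<bullet> w - a)) \<longrightarrow>
        chr w y = cis (2 * pi * a) * (1 + v w))" by blast
  qed
qed

text \<open>Compactness of the circle: finitely many arcs of fixed size cover all values of one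
  character, and each arc carries a plateau function whose support lies in a set where f is
  invertible.\<close>

lemma invertible_on_localize:
  assumes "0 < \<delta>" "\<delta> \<le> 1/2"
    and "\<And>a. invertible_on f {w\<in>X. cos (2 * pi * \<delta>) < cos (2 * pi * (y \<bullet> w - a))}"
  shows "invertible_on f X"
proof -
  obtain M :: nat where M: "1 / \<delta> < M" using reals_Archimedean2 by blast
  have "M > 0" using M assms by (metis divide_pos_pos gr0I of_nat_0 order_less_asym zero_less_one)
  \<comment> \<open>The plateaus have half-width q and centres at the multiples m q with m < M;
    since q = 1 / M they cover a full period, and q < \<open>\<delta>\<close> leaves room for the
    slopes.\<close>
  define q where "q = 1 / real M"
  have q: "0 < q" "q < \<delta>" using M \<open>M > 0\<close> assms by (auto simp: q_def field_simps)
  have less: "cos (2 * pi * \<delta>) < cos (2 * pi * q)"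
    using q assms by (intro cos_monotone_0_pi) auto
  have "\<exists>\<tau> C. fmult \<tau> C \<and> (\<forall>w. cos ((2 * pi) *\<^sub>R y \<bullet> w + - 2 * pi * a) \<le> cos (2 * pi * \<delta>) \<longrightarrow> \<tau> w = 0)
     \<and> (\<forall>w. cos (2 * pi * q) \<le> cos ((2 * pi) *\<^sub>R y \<bullet> w + - 2 * pi * a) \<longrightarrow> \<tau> w = 1)" for a
    using fmult_plateau[OF less, of "(2 * pi) *\<^sub>R y" "- 2 * pi * a"] by metis
  then have "\<exists>\<tau> C. fmult \<tau> C \<and> (\<forall>w. cos (2 * pi * (y \<bullet> w - a)) \<le> cos (2 * pi * \<delta>) \<longrightarrow> \<tau> w = 0)
     \<and> (\<forall>w. cos (2 * pi * q) \<le> cos (2 * pi * (y \<bullet> w - a)) \<longrightarrow> \<tau> w = 1)" for a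
    by (simp add: right_diff_distrib)
  then obtain \<tau> C where \<tau>: "\<And>a. fmult (\<tau> a) (C a)"
    "\<And>a w. cos (2 * pi * (y \<bullet> w - a)) \<le> cos (2 * pi * \<delta>) \<Longrightarrow> \<tau> a w = 0"
    "\<And>a w. cos (2 * pi * q) \<le> cos (2 * pi * (y \<bullet> w - a)) \<Longrightarrow> \<tau> a w = 1"
    by metis
  show ?thesis
  proof (rule invertible_on_glue_finite[of "{..<M}" "\<lambda>m. \<tau> (m * q)"])
    fix m
    show "\<exists>C. fmult (\<tau> (real m * q)) C" using \<tau>(1) by blast
    show "invertible_on f {w \<in> X. \<tau> (real m * q) w \<noteq> 0}"
      by (rule invertible_on_subset[OF assms(3)[of "m * q"]]) (use \<tau>(2) in \<open>force simp: not_le[symmetric]\<close>)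
  next
    fix w assume "w \<in> X"
    define u where "u = frac (y \<bullet> w)"
    have u: "0 \<le> u" "u < 1" by (auto simp: u_def frac_lt_1)
    define m where "m = nat \<lfloor>u * M\<rfloor>"
    have m: "real m \<le> u * M" "u * M < real m + 1"
      using u by (auto simp: m_def)
    have "u * M < M" using u \<open>M > 0\<close> by simp
    then have "m < M" using m by linarith
    have "cos (2 * pi * (y \<bullet> w - m * q)) = cos (2 * pi * (u - m * q) + 2 * pi * of_int \<lfloor>y \<bullet> w\<rfloor>)"
      by (simp add: u_def frac_def algebra_simps)
    also have "\<dots> = cos (2 * pi * (u - m * q))"
      by (simp only: cos_add sin_int_2pin cos_int_2pin mult_zero_right diff_zero mult_1_right)
    also have "\<dots> \<ge> cos (2 * pi * q)"
    proof (rule cos_monotone_0_pi_le)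
      have "m * q \<le> u" "u - m * q \<le> q"
        using m \<open>M > 0\<close> by (simp_all add: q_def pos_divide_le_eq diff_le_eq pos_le_divide_eq flip: add_divide_distrib)
      then show "0 \<le> 2 * pi * (u - m * q)" "2 * pi * (u - m * q) \<le> 2 * pi * q" by auto
      show "2 * pi * q \<le> pi" using q assms by simp
    qed
    finally have "\<tau> (m * q) w = 1" by (rule \<tau>(3))
    then show "\<exists>m\<in>{..<M}. \<tau> (real m * q) w = 1" using \<open>m < M\<close> by blast
  qed simp
qed

text \<open>Up to a tail of norm at most e / 8 only finitely many characters matter. On a cell where
  all of them are nearly constant, f = K + u with K constant and u of norm at most e / 4; a point of
  U in the cell forces |K| >= 3 e / 4, so f / K is inverted by a geometric series of ratio 1/3. The
  cells are then glued one character at a time.\<close>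

lemma wiener_inverse:
  fixes \<Gamma> U :: "'a::euclidean_space set"
  assumes sum: "(\<lambda>g. norm (\<beta> g)) summable_on \<Gamma>"
    and f: "\<And>w. f w = (\<Sum>\<^sub>\<infinity>g\<in>\<Gamma>. \<beta> g * chr w g)"
    and lower: "\<And>w. w \<in> U \<Longrightarrow> norm (f w) \<ge> e" and e: "e > 0"
  shows "invertible_on f U"
proof -
  have "\<forall>\<^sub>F G in finite_subsets_at_top \<Gamma>. dist (sum (\<lambda>g. norm (\<beta> g)) G) (\<Sum>\<^sub>\<infinity>g\<in>\<Gamma>. norm (\<beta> g)) < e / 8"
    using has_sum_infsum[OF sum] e unfolding has_sum_def by (intro tendstoD) auto
  then obtain G where G: "finite G" "G \<subseteq> \<Gamma>" 
     "dist (sum (\<lambda>g. norm (\<beta> g)) G) (\<Sum>\<^sub>\<infinity>g\<in>\<Gamma>. norm (\<beta> g)) < e / 8"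
    unfolding eventually_finite_subsets_at_top by blast
  have sum': "(\<lambda>g. norm (\<beta> g)) summable_on (\<Gamma> - G)"
    using sum by (rule summable_on_subset_banach) auto
  have split: "infsum h \<Gamma> = sum h G + infsum h (\<Gamma> - G)" if "h summable_on \<Gamma>" for h :: "'a \<Rightarrow> 'b::banach"
    using infsum_Un_disjoint[of h G "\<Gamma> - G"] that G
    by (auto simp: Un_absorb1 summable_on_subset_banach[OF that])
  define h where "h w = (\<Sum>\<^sub>\<infinity>g\<in>\<Gamma> - G. \<beta> g * chr w g)" for w
  have "fmult h (\<Sum>\<^sub>\<infinity>g\<in>\<Gamma> - G. norm (\<beta> g))"
    unfolding h_def by (rule fmult_infsum_chr[OF sum'])
  then have h: "fmult h (e / 8)"
    using G(3) split[OF sum] by (elim fmult_mono) (auto simp: dist_real_def)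
  have f_eq: "f w = (\<Sum>g\<in>G. \<beta> g * chr w g) + h w" for w
  proof -
    have "(\<lambda>g. \<beta> g * chr w g) summable_on \<Gamma>"
      by (rule abs_summable_summable) (use sum in \<open>simp add: norm_mult\<close>)
    then show ?thesis unfolding f h_def by (rule split)
  qed
  define B where "B = (\<Sum>g\<in>G. norm (\<beta> g))"
  have "B \<ge> 0" by (simp add: B_def sum_nonneg)
  \<comment> \<open>The deviations of the characters, weighted by coefficients of total size B, add
    up to at most e / 8. Using B + 1 covers the case B = 0.\<close>
  obtain \<delta> where \<delta>: "\<delta> > 0" "\<delta> \<le> 1/2"
    "\<And>(y::'a) a. \<exists>v. fmult v (e / (8 * (B + 1))) \<and> (\<forall>w. cos (2 * pi * \<delta>) < cos (2 * pi * (y \<bullet> w - a)) \<longrightarrow>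
        chr w y = cis (2 * pi * a) * (1 + v w))"
  proof (rule fmult_local_chr)
    show "e / (8 * (B + 1)) > 0" using e \<open>B \<ge> 0\<close> by simp
  qed blast
  have main: "invertible_on f {w\<in>U. \<forall>g\<in>G. cos (2 * pi * \<delta>) < cos (2 * pi * (g \<bullet> w - a g))}"
    (is "invertible_on f ?X") for a
  proof (cases "?X = {}")
    case True
    show ?thesis unfolding True by (rule invertible_on_empty)
  next
    case False
    then obtain w0 where w0: "w0 \<in> ?X" by blast
    have "\<forall>g. \<exists>v. fmult v (e / (8 * (B + 1))) \<and> (\<forall>w. cos (2 * pi * \<delta>) < cos (2 * pi * (g \<bullet> w - a g)) \<longrightarrow>
        chr w g = cis (2 * pi * a g) * (1 + v w))"
      using \<delta>(3) by blast
    from choice[OF this] obtain v where v: "\<And>g. fmult (v g) (e / (8 * (B + 1)))"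
      "\<And>g w. cos (2 * pi * \<delta>) < cos (2 * pi * (g \<bullet> w - a g)) \<Longrightarrow> chr w g = cis (2 * pi * a g) * (1 + v g w)"
      by blast
    define K where "K = (\<Sum>g\<in>G. \<beta> g * cis (2 * pi * a g))"
    define u where "u w = (\<Sum>g\<in>G. (\<beta> g * cis (2 * pi * a g)) * v g w) + h w" for w
    have "fmult u ((\<Sum>g\<in>G. norm (\<beta> g * cis (2 * pi * a g)) * (e / (8 * (B + 1)))) + e / 8)"
      unfolding u_def by (intro fmult_add fmult_sum fmult_cmult v h)
    also have "(\<Sum>g\<in>G. norm (\<beta> g * cis (2 * pi * a g)) * (e / (8 * (B + 1)))) = B * (e / (8 * (B + 1)))"
      by (simp only: norm_mult norm_cis mult_1_right B_def sum_distrib_right)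
    finally have "fmult u (e / 4)"
      by (rule fmult_mono) (use \<open>B \<ge> 0\<close> e in \<open>simp add: field_simps\<close>)
    have fu: "f w = K + u w" if "w \<in> ?X" for w
    proof -
      have "(\<Sum>g\<in>G. \<beta> g * chr w g) = (\<Sum>g\<in>G. \<beta> g * (cis (2 * pi * a g) * (1 + v g w)))"
        using that by (intro sum.cong refl arg_cong2[of _ _ _ _ "(*)"] v) auto
      then show ?thesis by (simp add: f_eq K_def u_def sum.distrib algebra_simps)
    qed
    \<comment> \<open>The lower bound for the constant comes from the one point \<open>w0\<close> of
      U in the cell; this is why empty cells are treated apart.\<close>
    have "norm K \<ge> 3 * e / 4"
      using fu[OF w0] lower[of w0] w0 fmult_bound[OF \<open>fmult u (e / 4)\<close>, of w0] norm_triangle_ineq[of K "u w0"]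
      by auto
    then have "K \<noteq> 0" using e by auto
    have "fmult (\<lambda>w. (- 1 / K) * u w) (norm (- 1 / K) * (e / 4))"
      by (intro fmult_cmult \<open>fmult u (e / 4)\<close>)
    then have "fmult (\<lambda>w. (- 1 / K) * u w) (1 / 3)"
      by (rule fmult_mono) (use \<open>norm K \<ge> 3 * e / 4\<close> e \<open>K \<noteq> 0\<close> in \<open>simp add: norm_divide field_simps\<close>)
    note s = fmult_cmult[OF fmult_inverse_one_minus[OF this], of "1 / K"]
    have "(1 / K) * inverse (1 - (- 1 / K) * u w) * f w = 1" if "w \<in> ?X" for w
    proof -
      have "norm (f w) > 0" using lower[of w] that e by auto
      then have "f w \<noteq> 0" by auto
      moreover have "f w = K * (1 - (- 1 / K) * u w)" using fu[OF that] \<open>K \<noteq> 0\<close> by (simp add: field_simps)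
      ultimately show ?thesis by (metis \<open>K \<noteq> 0\<close> divide_inverse inverse_mult_distrib left_inverse mult.left_neutral)
    qed
    with s show ?thesis unfolding invertible_on_def by (intro exI conjI ballI) auto
  qed
  \<comment> \<open>Induction on the number of characters not yet confined to an arc. The centres
    \<open>a\<close> vary in the induction, because confining g requires every possible centre b for
    it.\<close>
  have "invertible_on f {w\<in>U. \<forall>g\<in>G'. cos (2 * pi * \<delta>) < cos (2 * pi * (g \<bullet> w - a g))}"
    if "G' \<subseteq> G" for G' a
    using that
  proof (induction "card (G - G')" arbitrary: G' a)
    case 0
    then have "G' = G" using \<open>finite G\<close> by auto
    then show ?case using main by simp
  next
    case (Suc n)
    then obtain g where g: "g \<in> G" "g \<notin> G'"
      by (metis DiffE all_not_in_conv card.empty nat.distinct(1))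
    show ?case
    proof (rule invertible_on_localize[OF \<delta>(1,2), where y = g])
      fix b
      have "invertible_on f {w \<in> U. \<forall>g'\<in>insert g G'. cos (2 * pi * \<delta>) < cos (2 * pi * (g' \<bullet> w - (a(g := b)) g'))}"
      proof (rule Suc.hyps(1))
        have "G - insert g G' = (G - G') - {g}" by auto
        then show "n = card (G - insert g G')"
          using Suc.hyps(2) g \<open>finite G\<close> by (simp add: card_Diff_singleton)
      qed (use g Suc.prems in auto)
      then show "invertible_on f {w \<in> {w\<in>U. \<forall>g\<in>G'. cos (2 * pi * \<delta>) < cos (2 * pi * (g \<bullet> w - a g))}.
          cos (2 * pi * \<delta>) < cos (2 * pi * (g \<bullet> w - b))}"
        by (rule invertible_on_subset) (use g in auto)
    qed
  qed
  from this[of "{}"] show ?thesis by simp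
qed

section \<open>Almost periodicity\<close>

lemma exp_poly_alt: "exp_poly U P \<longleftrightarrow> (\<exists>F a. finite F \<and> F \<subseteq> U \<and> P = (\<lambda>x. \<Sum>w\<in>F. a w * chr w x))"
  by (simp add: exp_poly_def chr_def)

lemma exp_poly_diff:
  assumes "exp_poly U P" "exp_poly U Q"
  shows "exp_poly U (\<lambda>x. P x - Q x)"
proof -
  obtain F a where P: "finite F" "F \<subseteq> U" "P = (\<lambda>x. \<Sum>w\<in>F. a w * chr w x)"
    using assms(1) by (auto simp: exp_poly_alt)
  obtain F' a' where Q: "finite F'" "F' \<subseteq> U" "Q = (\<lambda>x. \<Sum>w\<in>F'. a' w * chr w x)"
    using assms(2) by (auto simp: exp_poly_alt)
  let ?a = "\<lambda>w. (if w \<in> F then a w else 0) - (if w \<in> F' then a' w else 0)"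
  have "P x = (\<Sum>w\<in>F \<union> F'. (if w \<in> F then a w else 0) * chr w x)"
       "Q x = (\<Sum>w\<in>F \<union> F'. (if w \<in> F' then a' w else 0) * chr w x)" for x
    unfolding P(3) Q(3) using P(1) Q(1) by (auto intro!: sum.mono_neutral_cong_left)
  then have "P x - Q x = (\<Sum>w\<in>F \<union> F'. ?a w * chr w x)" for x
    by (simp add: left_diff_distrib sum_subtractf)
  then show ?thesis
    unfolding exp_poly_alt using P(1,2) Q(1,2) by (intro exI[of _ "F \<union> F'"] exI[of _ ?a]) auto
qed

lemma continuous_on_chr [continuous_intros]: "continuous_on S (chr w)"
proof -
  have "chr w = (\<lambda>x. exp (\<i> * of_real (2 * pi * (x \<bullet> w))))"
    by (simp add: fun_eq_iff chr_def cis_conv_exp)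
  then show ?thesis by (auto intro!: continuous_intros)
qed

text \<open>Kronecker-type recurrence from the pigeonhole principle: colour x by the cells of a finite net
  of the unit circle that contain the values of the characters at x.\<close>
lemma relatively_dense_near_periods:
  fixes F :: "'a::euclidean_space set"
  assumes "finite F" "\<eta> > 0"
  obtains L where "L > 0" "\<And>a. \<exists>\<tau>\<in>ball a L. \<forall>w\<in>F. norm (chr w \<tau> - 1) < \<eta>"
proof -
  have "compact (sphere (0::complex) 1)" by simp
  then obtain T where T: "finite T" "sphere (0::complex) 1 \<subseteq> (\<Union>t\<in>T. ball t (\<eta> / 2))"
    using assms by (auto simp: compact_eq_totally_bounded dest!: spec[of _ "\<eta> / 2"])
  then have "\<forall>z\<in>sphere 0 1. \<exists>t\<in>T. dist t z < \<eta> / 2" by (auto simp: subset_iff)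
  then obtain col where col: "\<And>z::complex. norm z = 1 \<Longrightarrow> col z \<in> T" "\<And>z. norm z = 1 \<Longrightarrow> dist (col z) z < \<eta> / 2"
    by (metis dist_0_norm mem_sphere)
  define \<Phi> where "\<Phi> x = restrict (\<lambda>w. col (chr w x)) F" for x
  have "range \<Phi> \<subseteq> PiE F (\<lambda>_. T)" by (auto simp: \<Phi>_def col)
  then have fin: "finite (range \<Phi>)"
    using finite_PiE[OF \<open>finite F\<close>, of "\<lambda>_. T"] T finite_subset by blast
  \<comment> \<open>One representative for each of the finitely many colours; L exceeds the norms of
    all of them, so subtracting from a the representative of its colour moves it by less than L. The
    difference is the near-period.\<close>
  define r where "r = inv \<Phi>"
  define L where "L = 1 + (\<Sum>p\<in>range \<Phi>. norm (r p))"
  show ?thesis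
  proof (rule that)
    show "L > 0" unfolding L_def by (intro add_pos_nonneg sum_nonneg) auto
    fix a
    let ?x = "r (\<Phi> a)"
    have eq: "\<Phi> ?x = \<Phi> a" by (simp add: r_def f_inv_into_f)
    have "norm ?x < L"
      using member_le_sum[of "\<Phi> a" "range \<Phi>" "\<lambda>p. norm (r p)"] fin by (auto simp: L_def)
    then have "a - ?x \<in> ball a L" by (simp add: dist_norm)
    moreover have "norm (chr w (a - ?x) - 1) < \<eta>" if "w \<in> F" for w
    proof -
      have "col (chr w ?x) = col (chr w a)" using eq that by (metis \<Phi>_def restrict_apply)
      then have "dist (chr w a) (chr w ?x) < \<eta>"
        using col(2)[of "chr w a"] col(2)[of "chr w ?x"]
        by (metis dist_commute dist_triangle_half_l norm_chr)
      moreover have "chr w a = chr w (a - ?x) * chr w ?x" by (simp flip: chr_add)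
      then have "chr w a - chr w ?x = (chr w (a - ?x) - 1) * chr w ?x" by (simp add: algebra_simps)
      then have "dist (chr w a) (chr w ?x) = norm (chr w (a - ?x) - 1)" by (simp add: dist_norm norm_mult)
      ultimately show ?thesis by simp
    qed
    ultimately show "\<exists>\<tau>\<in>ball a L. \<forall>w\<in>F. norm (chr w \<tau> - 1) < \<eta>" by blast
  qed
qed

lemma bohr_exp_poly:
  assumes "exp_poly U P"
  shows "bohr_almost_periodic P"
proof -
  obtain F a where P: "finite F" "P = (\<lambda>x. \<Sum>w\<in>F. a w * chr w x)"
    using assms by (auto simp: exp_poly_alt)
  define A where "A = (\<Sum>w\<in>F. norm (a w))"
  have "A \<ge> 0" by (simp add: A_def sum_nonneg)
  show ?thesis
    unfolding bohr_almost_periodic_def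
  proof (intro conjI allI impI)
    show "continuous_on UNIV P" unfolding P by (intro continuous_intros)
    fix e :: real assume "e > 0"
    then have "e / (1 + A) > 0" using \<open>A \<ge> 0\<close> by simp
    then obtain L where L: "L > 0" "\<And>c. \<exists>\<tau>\<in>ball c L. \<forall>w\<in>F. norm (chr w \<tau> - 1) < e / (1 + A)"
      using relatively_dense_near_periods[OF P(1)] by metis
    have "norm (P (x + \<tau>) - P x) \<le> e" if \<tau>: "\<forall>w\<in>F. norm (chr w \<tau> - 1) < e / (1 + A)" for x \<tau>
    proof -
      have "P (x + \<tau>) - P x = (\<Sum>w\<in>F. a w * chr w x * (chr w \<tau> - 1))"
        by (simp add: P chr_add sum_subtractf algebra_simps)
      also have "norm \<dots> \<le> (\<Sum>w\<in>F. norm (a w) * (e / (1 + A)))"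
      proof (intro sum_norm_le)
        fix w assume "w \<in> F"
        then have "norm (chr w \<tau> - 1) \<le> e / (1 + A)" using \<tau> by (simp add: less_imp_le)
        then show "norm (a w * chr w x * (chr w \<tau> - 1)) \<le> norm (a w) * (e / (1 + A))"
          unfolding norm_mult norm_chr mult_1_right by (rule mult_left_mono) simp
      qed
      also have "\<dots> = A * (e / (1 + A))" by (simp only: A_def sum_distrib_right)
      also have "\<dots> \<le> e" using \<open>A \<ge> 0\<close> \<open>e > 0\<close> by (simp add: field_simps)
      finally show ?thesis .
    qed
    then show "\<exists>L>0. \<forall>a. \<exists>\<tau>\<in>ball a L. \<forall>x. norm (P (x + \<tau>) - P x) \<le> e"
      using L by meson
  qed
qed

lemma bohr_uniform_limit:
  assumes "\<And>n::nat. bohr_almost_periodic (P n)" "uniform_limit UNIV P f sequentially"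
  shows "bohr_almost_periodic f"
  unfolding bohr_almost_periodic_def
proof (intro conjI allI impI)
  show "continuous_on UNIV f"
    using assms by (intro uniform_limit_theorem[OF _ assms(2)]) (auto simp: bohr_almost_periodic_def)
  fix e :: real assume "e > 0"
  then have "\<forall>\<^sub>F n in sequentially. \<forall>x\<in>UNIV. dist (P n x) (f x) < e / 3"
    using assms(2) by (intro uniform_limitD) auto
  then obtain n where n: "\<And>x. norm (P n x - f x) < e / 3"
    by (auto simp: eventually_sequentially dist_norm)
  obtain L where L: "L > 0" "\<And>a. \<exists>\<tau>\<in>ball a L. \<forall>x. norm (P n (x + \<tau>) - P n x) \<le> e / 3"
    using assms(1)[of n] \<open>e > 0\<close> unfolding bohr_almost_periodic_def by (metis divide_pos_pos zero_less_numeral)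
  have "norm (f (x + \<tau>) - f x) \<le> e" if "norm (P n (x + \<tau>) - P n x) \<le> e / 3" for x \<tau>
  proof -
    have "f (x + \<tau>) - f x = (P n (x + \<tau>) - P n x) - (P n (x + \<tau>) - f (x + \<tau>)) + (P n x - f x)" by simp
    also have "norm \<dots> \<le> norm (P n (x + \<tau>) - P n x) + norm (P n (x + \<tau>) - f (x + \<tau>)) + norm (P n x - f x)"
      by (rule order_trans[OF norm_triangle_ineq add_right_mono[OF norm_triangle_ineq4]])
    finally show ?thesis using that n[of x] n[of "x + \<tau>"] by linarith
  qed
  then show "\<exists>L>0. \<forall>a. \<exists>\<tau>\<in>ball a L. \<forall>x. norm (f (x + \<tau>) - f x) \<le> e"
    using L by meson
qed

text \<open>One K and one C serve all P, in particular the differences of members of a sequence;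
  uniform Cauchyness on K therefore spreads to the whole space.\<close>

lemma coherent_frequenciesI:
  assumes "uniformly_discrete U" "compact K"
    and est: "\<And>P B x. exp_poly U P \<Longrightarrow> (\<And>x. x \<in> K \<Longrightarrow> norm (P x) \<le> B) \<Longrightarrow> norm (P x) \<le> C * B"
  shows "coherent_frequencies U"
  unfolding coherent_frequencies_def
proof (intro conjI allI impI)
  fix P f assume *: "(\<forall>n. exp_poly U (P n)) \<and> (\<forall>K. compact K \<longrightarrow> uniform_limit K P f sequentially)"
  have "uniform_limit UNIV P f sequentially"
  proof (rule uniform_limitI)
    fix e :: real assume "e > 0"
    \<comment> \<open>C may be zero or negative, so a positive upper bound is used for the
      division.\<close>
    obtain k where k: "k > 0" "C \<le> k" by (auto intro: that[of "\<bar>C\<bar> + 1"])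
    define d where "d = e / (2 * k)"
    have "d > 0" using \<open>e > 0\<close> k by (simp add: d_def)
    have "uniform_limit K P f sequentially" using * assms by blast
    then have "\<forall>\<^sub>F n in sequentially. \<forall>x\<in>K. dist (P n x) (f x) < d / 2"
      using \<open>d > 0\<close> by (intro uniform_limitD) auto
    then obtain N where N: "\<And>n x. n \<ge> N \<Longrightarrow> x \<in> K \<Longrightarrow> dist (P n x) (f x) < d / 2"
      by (auto simp: eventually_sequentially)
    have Cauchy: "norm (P n x - P m x) \<le> e / 2" if "n \<ge> N" "m \<ge> N" for n m x
    proof -
      have "exp_poly U (\<lambda>x. P n x - P m x)" using * by (intro exp_poly_diff) auto
      then have "norm (P n x - P m x) \<le> C * d"
      proof (rule est)
        fix x assume "x \<in> K"
        then show "norm (P n x - P m x) \<le> d"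
          using N[of n x] N[of m x] that dist_triangle_half_l[of "P n x" "f x" d "P m x"]
          by (simp add: dist_norm norm_minus_commute)
      qed
      also have "\<dots> \<le> k * d" using \<open>d > 0\<close> k by (intro mult_right_mono) auto
      also have "\<dots> = e / 2" using k by (simp add: d_def)
      finally show ?thesis .
    qed
    have "dist (P n x) (f x) \<le> e / 2" if "n \<ge> N" for n x
    proof -
      have "uniform_limit {x} P f sequentially" using *[THEN conjunct2, rule_format, of "{x}"] by simp
      then have "(\<lambda>m. P m x) \<longlonglongrightarrow> f x" by (rule tendsto_uniform_limitI) simp
      then have "(\<lambda>m. norm (P n x - P m x)) \<longlonglongrightarrow> norm (P n x - f x)" by (intro tendsto_intros)
      then have "norm (P n x - f x) \<le> e / 2"
        by (rule LIMSEQ_le_const2) (intro exI[of _ N] allI impI Cauchy that)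
      then show ?thesis by (simp add: dist_norm)
    qed
    moreover have "e / 2 < e" using \<open>e > 0\<close> by simp
    ultimately show "\<forall>\<^sub>F n in sequentially. \<forall>x\<in>UNIV. dist (P n x) (f x) < e"
      unfolding eventually_sequentially by (meson order.strict_trans1)
  qed
  then show "bohr_almost_periodic f"
    by (rule bohr_uniform_limit[rotated]) (use * bohr_exp_poly in blast)
qed (use assms in auto)

section \<open>Sums over translation bounded measures\<close>

lemma
  fixes f :: "'a::euclidean_space \<Rightarrow> real \<Rightarrow> complex"
  assumes "\<And>i. i \<in> Basis \<Longrightarrow> integrable lborel (f i)"
  shows integrable_lborel_prod: "integrable lborel (\<lambda>x::'a. \<Prod>i\<in>Basis. f i (x \<bullet> i))"
    and integral_lborel_prod: "(\<integral>x. (\<Prod>i\<in>Basis. f i (x \<bullet> i)) \<partial>lborel) = (\<Prod>i\<in>Basis. \<integral>t. f i t \<partial>lborel)"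
proof -
  interpret product_sigma_finite "\<lambda>_::'a. lborel::real measure" ..
  have meas: "f i \<in> borel_measurable borel" if "i \<in> Basis" for i
    using borel_measurable_integrable[OF assms[OF that]] by simp
  have [measurable]: "(\<lambda>x::'a. \<Prod>i\<in>Basis. f i (x \<bullet> i)) \<in> borel_measurable borel"
    by (intro borel_measurable_prod measurable_compose[OF _ meas]) auto
  have [measurable]: "(\<lambda>f. \<Sum>b\<in>(Basis::'a set). f b *\<^sub>R b) \<in> (\<Pi>\<^sub>M b\<in>Basis. lborel) \<rightarrow>\<^sub>M borel"
    by measurable
  have eq: "(\<Prod>i\<in>Basis. f i ((\<Sum>b\<in>Basis. g b *\<^sub>R b) \<bullet> i)) = (\<Prod>i\<in>Basis. f i (g i))" for g
    by (intro prod.cong refl arg_cong[where f = "f _"]) simp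
  have "integrable (\<Pi>\<^sub>M b\<in>(Basis::'a set). lborel) (\<lambda>g. \<Prod>i\<in>Basis. f i (g i))"
    using assms by (intro product_integrable_prod) auto
  then show "integrable lborel (\<lambda>x::'a. \<Prod>i\<in>Basis. f i (x \<bullet> i))"
    by (subst lborel_eq, subst integrable_distr_eq) (simp_all only: eq, measurable)
  have "(\<integral>x. (\<Prod>i\<in>Basis. f i (x \<bullet> i)) \<partial>lborel) = (\<integral>g. (\<Prod>i\<in>Basis. f i (g i)) \<partial>(\<Pi>\<^sub>M b\<in>(Basis::'a set). lborel))"
    by (subst lborel_eq, subst integral_distr) (simp_all only: eq, measurable)
  also have "\<dots> = (\<Prod>i\<in>Basis. \<integral>t. f i t \<partial>lborel)"
    using assms by (intro product_integral_prod) auto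
  finally show "(\<integral>x. (\<Prod>i\<in>Basis. f i (x \<bullet> i)) \<partial>lborel) = (\<Prod>i\<in>Basis. \<integral>t. f i t \<partial>lborel)" .
qed

text \<open>The common majorant for all kernels: it decays as the product of Fejer kernels does, is
  integrable, and changes by at most a constant factor over unit distances.\<close>

definition pkern :: "'a::euclidean_space \<Rightarrow> real" where
  "pkern y = (\<Prod>i\<in>Basis. 1 / (1 + (y \<bullet> i)\<^sup>2))"

lemma one_plus_square_pos [simp]: "0 < 1 + (x::real)\<^sup>2" "1 + x\<^sup>2 \<noteq> 0"
  by (smt (verit) zero_le_power2)+

lemma pkern_pos: "0 < pkern y"
  by (auto simp: pkern_def intro!: prod_pos)

lemma borel_measurable_pkern [measurable]: "pkern \<in> borel_measurable borel"
  unfolding pkern_def[abs_def] by measurable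

lemma integrable_pkern: "integrable lborel pkern"
proof -
  have "set_integrable lborel (einterval (-\<infinity>) \<infinity>) (\<lambda>x. inverse (1 + x\<^sup>2))"
    using integrable_inverse_1_plus_square by simp
  then have "integrable lborel (\<lambda>t::real. inverse (1 + t\<^sup>2))"
    by (simp add: set_integrable_def)
  then have "integrable lborel (\<lambda>t. complex_of_real (1 / (1 + t\<^sup>2)))"
    by (intro integrable_of_real) (simp add: field_simps)
  then have "integrable lborel (\<lambda>y::'a. \<Prod>i\<in>Basis. complex_of_real (1 / (1 + (y \<bullet> i)\<^sup>2)))"
    by (intro integrable_lborel_prod)
  then have "integrable lborel (\<lambda>y::'a. complex_of_real (pkern y))"
    by (simp add: pkern_def)
  then show ?thesis by (simp only: complex_of_real_integrable_eq)
qed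

lemma pkern_le:
  assumes "dist x y \<le> 1"
  shows "pkern x \<le> 3 ^ DIM('a) * pkern (y::'a::euclidean_space)"
proof -
  have "1 / (1 + (x \<bullet> i)\<^sup>2) \<le> 3 * (1 / (1 + (y \<bullet> i)\<^sup>2))" if "i \<in> Basis" for i
  proof -
    have "\<bar>x \<bullet> i - y \<bullet> i\<bar> \<le> 1"
      using Basis_le_norm[OF that, of "x - y"] assms by (simp add: dist_norm inner_diff_left)
    then have "(x \<bullet> i - y \<bullet> i)\<^sup>2 \<le> 1" by (simp add: abs_square_le_1)
    \<comment> \<open>The right side minus the left is the square of 2 x - y in this
      coordinate.\<close>
    moreover have "(y \<bullet> i)\<^sup>2 \<le> 2 * (x \<bullet> i)\<^sup>2 + 2 * (x \<bullet> i - y \<bullet> i)\<^sup>2"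
      using zero_le_power2[of "2 * (x \<bullet> i) - y \<bullet> i"] by (simp add: power2_eq_square algebra_simps)
    ultimately have "1 + (y \<bullet> i)\<^sup>2 \<le> 3 * (1 + (x \<bullet> i)\<^sup>2)" by (smt (verit) zero_le_power2)
    then show ?thesis by (simp add: divide_simps)
  qed
  then have "pkern x \<le> (\<Prod>i\<in>(Basis::'a set). 3 * (1 / (1 + (y \<bullet> i)\<^sup>2)))"
    unfolding pkern_def by (intro prod_mono) auto
  also have "\<dots> = 3 ^ DIM('a) * pkern y"
    by (simp only: prod.distrib prod_constant pkern_def)
  finally show ?thesis .
qed

text \<open>The sum is compared with an integral by averaging over unit balls around the atoms.\<close>
lemma translation_bounded_sum:
  fixes b :: "'a::euclidean_space \<Rightarrow> complex"
  assumes "translation_bounded b"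
  shows "\<exists>C\<ge>0. \<forall>x F T. finite F \<longrightarrow> T \<in> sets borel \<longrightarrow> (\<forall>g\<in>F. ball (g + x) 1 \<subseteq> T) \<longrightarrow>
     (\<Sum>g\<in>F. norm (b g) * pkern (g + x)) \<le> C * (\<integral>y. indicator T y * pkern y \<partial>lborel)"
proof -
  obtain M where M: "\<And>t F. finite F \<Longrightarrow> F \<subseteq> ball t 1 \<Longrightarrow> (\<Sum>x\<in>F. norm (b x)) \<le> M"
    using assms unfolding translation_bounded_def by blast
  have "M \<ge> 0" using M[of "{}"] by simp
  define v where "v = measure lborel (ball (0::'a) 1)"
  have v: "measure lborel (ball (z::'a) 1) = v" for z
    by (simp add: v_def content_ball)
  have "v > 0" by (simp add: v_def content_ball_pos)
  define D :: real where "D = 3 ^ DIM('a)"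
  have "D > 0" by (simp add: D_def)
  show ?thesis
  \<comment> \<open>D compares \<open>pkern\<close> at the centre and at the points of a unit ball,
    M bounds the mass of a unit ball, and v is the volume over which the average is taken.\<close>
  proof (intro exI[of _ "D * M / v"] conjI allI impI)
    show "D * M / v \<ge> 0" using \<open>M \<ge> 0\<close> \<open>v > 0\<close> \<open>D > 0\<close> by simp
    fix x :: 'a and F T assume F: "finite F" and [measurable]: "T \<in> sets borel"
      and T: "\<forall>g\<in>F. ball (g + x) 1 \<subseteq> T"
    have int: "integrable lborel (\<lambda>y. indicator S y * pkern (y::'a))" if "S \<in> sets borel" for S
      using that by (intro Bochner_Integration.integrable_bound[OF integrable_pkern]) (auto split: split_indicator simp: abs_mult)
    have ind: "integrable lborel (\<lambda>y. indicator (ball z 1) y :: real)" for z :: 'a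
      using emeasure_bounded_finite[OF bounded_ball, of z 1] by (intro integrable_real_indicator) simp_all
    have "v * (\<Sum>g\<in>F. norm (b g) * pkern (g + x)) = (\<Sum>g\<in>F. \<integral>y. norm (b g) * pkern (g + x) * indicator (ball (g + x) 1) y \<partial>lborel)"
      using v by (simp add: sum_distrib_left mult_ac)
    also have "\<dots> = (\<integral>y. (\<Sum>g\<in>F. norm (b g) * pkern (g + x) * indicator (ball (g + x) 1) y) \<partial>lborel)"
      using ind by (subst Bochner_Integration.integral_sum) auto
    also have "\<dots> \<le> (\<integral>y. D * M * (indicator T y * pkern y) \<partial>lborel)"
    proof (rule integral_mono)
      show "integrable lborel (\<lambda>y. \<Sum>g\<in>F. norm (b g) * pkern (g + x) * indicator (ball (g + x) 1) y)"
        using ind by (intro Bochner_Integration.integrable_sum integrable_mult_right) auto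
      show "integrable lborel (\<lambda>y. D * M * (indicator T y * pkern y))"
        by (intro integrable_mult_right int) simp
      fix y
      have "(\<Sum>g\<in>F. norm (b g) * pkern (g + x) * indicator (ball (g + x) 1) y)
          = (\<Sum>g\<in>{g\<in>F. y \<in> ball (g + x) 1}. norm (b g) * pkern (g + x))"
        using F by (simp add: indicator_def if_distrib sum.If_cases Int_def cong: if_cong)
      also have "\<dots> \<le> (\<Sum>g\<in>{g\<in>F. y \<in> ball (g + x) 1}. norm (b g) * (D * (indicator T y * pkern y)))"
      proof (intro sum_mono mult_left_mono)
        fix g assume g: "g \<in> {g\<in>F. y \<in> ball (g + x) 1}"
        then have "y \<in> T" using T by blast
        moreover have "pkern (g + x) \<le> D * pkern y" using g unfolding D_def by (intro pkern_le) auto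
        ultimately show "pkern (g + x) \<le> D * (indicator T y * pkern y)" by simp
      qed simp
      also have "\<dots> = (\<Sum>g\<in>{g\<in>F. y \<in> ball (g + x) 1}. norm (b g)) * (D * (indicator T y * pkern y))"
        by (simp only: sum_distrib_right)
      \<comment> \<open>All atoms g with y in the unit ball about g + x lie in the unit ball about y
        - x, whose mass is at most M.\<close>
      also have "\<dots> \<le> M * (D * (indicator T y * pkern y))"
      proof (intro mult_right_mono M)
        show "{g\<in>F. y \<in> ball (g + x) 1} \<subseteq> ball (y - x) 1"
          by (auto simp: dist_norm norm_minus_commute algebra_simps)
      qed (use F \<open>D > 0\<close> pkern_pos[of y] in auto)
      finally show "(\<Sum>g\<in>F. norm (b g) * pkern (g + x) * indicator (ball (g + x) 1) y) \<le> D * M * (indicator T y * pkern y)"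
        by (simp add: mult_ac)
    qed
    finally have "v * (\<Sum>g\<in>F. norm (b g) * pkern (g + x)) \<le> D * M * (\<integral>y. indicator T y * pkern y \<partial>lborel)"
      by simp
    then show "(\<Sum>g\<in>F. norm (b g) * pkern (g + x)) \<le> D * M / v * (\<integral>y. indicator T y * pkern y \<partial>lborel)"
      using \<open>v > 0\<close> by (simp add: field_simps)
  qed
qed

text \<open>The case T = UNIV of the comparison; what matters is that the bound is uniform in
  x.\<close>

lemma translation_bounded_summable:
  fixes b :: "'a::euclidean_space \<Rightarrow> complex"
  assumes "translation_bounded b"
  shows "\<exists>C. \<forall>x \<Gamma>. (\<lambda>g. norm (b g) * pkern (g + x)) summable_on \<Gamma> \<and>
     (\<Sum>\<^sub>\<infinity>g\<in>\<Gamma>. norm (b g) * pkern (g + x)) \<le> C"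
proof -
  obtain C where C: "C \<ge> 0" "\<And>x F T. finite F \<Longrightarrow> T \<in> sets borel \<Longrightarrow> \<forall>g\<in>F. ball (g + x) 1 \<subseteq> T \<Longrightarrow>
     (\<Sum>g\<in>F. norm (b g) * pkern (g + x)) \<le> C * (\<integral>y. indicator T y * pkern y \<partial>lborel)"
    using translation_bounded_sum[OF assms] by blast
  let ?C = "C * (\<integral>y. indicator UNIV y * pkern (y::'a) \<partial>lborel)"
  have *: "(\<Sum>g\<in>F. norm (b g) * pkern (g + x)) \<le> ?C" if "finite F" for F x
    using that by (intro C(2)) auto
  have s: "(\<lambda>g. norm (b g) * pkern (g + x)) summable_on \<Gamma>" for x \<Gamma>
    by (rule nonneg_bdd_above_summable_on)
       (use * in \<open>auto intro!: bdd_aboveI[of _ ?C] mult_nonneg_nonneg less_imp_le[OF pkern_pos]\<close>)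
  moreover have "(\<Sum>\<^sub>\<infinity>g\<in>\<Gamma>. norm (b g) * pkern (g + x)) \<le> ?C" for x \<Gamma>
    by (rule infsum_le_finite_sums[OF s *])
  ultimately show ?thesis by blast
qed

text \<open>The same comparison with T the complement of a large ball, over which the integral of
  \<open>pkern\<close> is small. Again the radius does not depend on x.\<close>

lemma translation_bounded_tail:
  fixes b :: "'a::euclidean_space \<Rightarrow> complex"
  assumes "translation_bounded b" "\<delta> > 0"
  obtains R where "\<And>x \<Gamma>. (\<Sum>\<^sub>\<infinity>g\<in>{g\<in>\<Gamma>. norm (g + x) > R}. norm (b g) * pkern (g + x)) \<le> \<delta>"
proof -
  obtain C where C: "C \<ge> 0" "\<And>x F T. finite F \<Longrightarrow> T \<in> sets borel \<Longrightarrow> \<forall>g\<in>F. ball (g + x) 1 \<subseteq> T \<Longrightarrow>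
     (\<Sum>g\<in>F. norm (b g) * pkern (g + x)) \<le> C * (\<integral>y. indicator T y * pkern y \<partial>lborel)"
    using translation_bounded_sum[OF assms(1)] by blast
  obtain D where D: "\<And>x \<Gamma>. (\<lambda>g. norm (b g) * pkern (g + x)) summable_on \<Gamma>"
     "\<And>x \<Gamma>. (\<Sum>\<^sub>\<infinity>g\<in>\<Gamma>. norm (b g) * pkern (g + x)) \<le> D"
    using translation_bounded_summable[OF assms(1)] by blast
  have "(\<lambda>n. \<integral>y. indicator {y. norm y > real n} y * pkern (y::'a) \<partial>lborel) \<longlonglongrightarrow> integral\<^sup>L lborel (\<lambda>y::'a. 0)"
  proof (rule integral_dominated_convergence[OF _ _ integrable_pkern])
    show "AE y in lborel. (\<lambda>n. indicator {y. norm y > real n} y * pkern (y::'a)) \<longlonglongrightarrow> 0"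
    proof (rule AE_I2)
      fix y :: 'a
      obtain N :: nat where "norm y \<le> N" using real_arch_simple by blast
      then have "\<forall>\<^sub>F n in sequentially. indicator {y. norm y > real n} y * pkern y = 0"
        by (auto simp: eventually_sequentially intro!: exI[of _ N])
      then show "(\<lambda>n. indicator {y. norm y > real n} y * pkern y) \<longlonglongrightarrow> 0"
        by (rule tendsto_eventually)
    qed
    show "AE y in lborel. norm (indicator {y. norm y > real n} y * pkern (y::'a)) \<le> pkern y" for n
      using less_imp_le[OF pkern_pos] by (intro AE_I2) (auto split: split_indicator)
  qed measurable
  then have "(\<lambda>n. C * (\<integral>y. indicator {y. norm y > real n} y * pkern (y::'a) \<partial>lborel)) \<longlonglongrightarrow> C * 0"
    by (intro tendsto_intros) simp
  then have "\<forall>\<^sub>F n in sequentially. C * (\<integral>y. indicator {y. norm y > real n} y * pkern (y::'a) \<partial>lborel) < \<delta>"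
    using \<open>\<delta> > 0\<close> by (intro order_tendstoD) auto
  then obtain n where n: "C * (\<integral>y. indicator {y. norm y > real n} y * pkern (y::'a) \<partial>lborel) < \<delta>"
    by (auto simp: eventually_sequentially)
  show ?thesis
  proof (rule that)
    \<comment> \<open>The radius n + 1 leaves room for unit balls: those around the remaining points
      g + x stay in the set norm y > n.\<close>
    fix x :: 'a and \<Gamma> :: "'a set"
    show "(\<Sum>\<^sub>\<infinity>g\<in>{g\<in>\<Gamma>. norm (g + x) > real n + 1}. norm (b g) * pkern (g + x)) \<le> \<delta>"
    proof (rule infsum_le_finite_sums[OF D(1)])
      fix F assume F: "finite F" "F \<subseteq> {g\<in>\<Gamma>. norm (g + x) > real n + 1}"
      have "(\<Sum>g\<in>F. norm (b g) * pkern (g + x)) \<le> C * (\<integral>y. indicator {y. norm y > real n} y * pkern (y::'a) \<partial>lborel)"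
      proof (rule C(2)[OF F(1)])
        have "norm y > real n" if "g \<in> F" "dist (g + x) y < 1" for g y
          using that F norm_triangle_sub[of "g + x" y] by (force simp: dist_norm)
        then show "\<forall>g\<in>F. ball (g + x) 1 \<subseteq> {y. norm y > real n}" by auto
      qed measurable
      then show "(\<Sum>g\<in>F. norm (b g) * pkern (g + x)) \<le> \<delta>" using n by linarith
    qed
  qed
qed

section \<open>Interchange of integrals and absolutely convergent sums\<close>

lemma
  fixes f :: "'b \<Rightarrow> 'a::euclidean_space \<Rightarrow> complex"
  assumes "countable \<Gamma>" and meas: "\<And>g. g \<in> \<Gamma> \<Longrightarrow> f g \<in> borel_measurable borel"
    and bound: "\<And>g y. g \<in> \<Gamma> \<Longrightarrow> norm (f g y) \<le> B g * H y"
    and B: "B summable_on \<Gamma>" and H: "integrable lborel H"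
  shows integrable_infsum: "integrable lborel (\<lambda>y. \<Sum>\<^sub>\<infinity>g\<in>\<Gamma>. f g y)"
    and integral_infsum: "(\<integral>y. (\<Sum>\<^sub>\<infinity>g\<in>\<Gamma>. f g y) \<partial>lborel) = (\<Sum>\<^sub>\<infinity>g\<in>\<Gamma>. \<integral>y. f g y \<partial>lborel)"
proof -
  have int: "integrable lborel (f g)" if "g \<in> \<Gamma>" for g
    by (rule Bochner_Integration.integrable_bound[OF integrable_mult_right[OF H, of "B g"]])
       (use meas[OF that] bound[OF that] in \<open>auto intro!: AE_I2 order_trans[OF _ abs_ge_self]\<close>)
  have "integrable lborel (\<lambda>y. \<Sum>\<^sub>\<infinity>g\<in>\<Gamma>. f g y) \<and>
     (\<integral>y. (\<Sum>\<^sub>\<infinity>g\<in>\<Gamma>. f g y) \<partial>lborel) = (\<Sum>\<^sub>\<infinity>g\<in>\<Gamma>. \<integral>y. f g y \<partial>lborel)"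
  proof (cases "finite \<Gamma>")
    case True
    then show ?thesis using int by simp
  next
    case False
    define e where "e = from_nat_into \<Gamma>"
    have e: "bij_betw e UNIV \<Gamma>" unfolding e_def by (rule bij_betw_from_nat_into[OF assms(1) False])
    have e\<Gamma>: "e n \<in> \<Gamma>" for n using e by (auto simp: bij_betw_def)
    have series: "infsum u \<Gamma> = (\<Sum>n. u (e n))" "summable (\<lambda>n. norm (u (e n)))"
      if "(\<lambda>g. norm (u g)) summable_on \<Gamma>" for u :: "'b \<Rightarrow> complex"
    proof -
      have *: "(\<lambda>n. norm (u (e n))) summable_on UNIV"
        using summable_on_reindex_bij_betw[OF e, of "\<lambda>g. norm (u g)"] that by simp
      then show "summable (\<lambda>n. norm (u (e n)))" by (simp add: summable_on_UNIV_nonneg_real_iff)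
      have "(\<lambda>n. u (e n)) summable_on UNIV" using * by (rule abs_summable_summable)
      then have "((\<lambda>n. u (e n)) has_sum infsum (\<lambda>n. u (e n)) UNIV) UNIV" by (rule has_sum_infsum)
      then have "(\<lambda>n. u (e n)) sums infsum (\<lambda>n. u (e n)) UNIV" by (rule has_sum_imp_sums)
      then show "infsum u \<Gamma> = (\<Sum>n. u (e n))"
        using infsum_reindex_bij_betw[OF e, of u] by (simp add: sums_iff)
    qed
    \<comment> \<open>B carries no sign assumption, and for real families summability is
      absolute.\<close>
    have absB: "(\<lambda>g. \<bar>B g\<bar>) summable_on \<Gamma>"
      using B summable_on_iff_abs_summable_on_real by force
    have sum1: "(\<lambda>g. norm (f g y)) summable_on \<Gamma>" for y
      by (rule summable_on_comparison_test[OF summable_on_cmult_left[OF B, of "H y"]])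
         (use bound in auto)
    define J where "J = (\<integral>y. \<bar>H y\<bar> \<partial>lborel)"
    have Jle: "(\<integral>y. norm (f g y) \<partial>lborel) \<le> \<bar>B g\<bar> * J" if "g \<in> \<Gamma>" for g
    proof -
      have "(\<integral>y. norm (f g y) \<partial>lborel) \<le> (\<integral>y. \<bar>B g\<bar> * \<bar>H y\<bar> \<partial>lborel)"
        using int[OF that] H bound[OF that]
        by (intro integral_mono) (auto simp flip: abs_mult intro: order_trans[OF _ abs_ge_self])
      then show ?thesis by (simp add: J_def)
    qed
    have sumB: "summable (\<lambda>n. \<bar>B (e n)\<bar> * J)"
      using summable_on_reindex_bij_betw[OF e, of "\<lambda>g. \<bar>B g\<bar>"] absB
      by (intro summable_mult2) (simp add: summable_on_UNIV_nonneg_real_iff)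
    have sum2: "(\<lambda>g. norm (\<integral>y. f g y \<partial>lborel)) summable_on \<Gamma>"
      by (rule summable_on_comparison_test[OF summable_on_cmult_left[OF absB, of J]])
         (auto intro: order_trans[OF integral_norm_bound Jle])
    have *: "AE y in lborel. summable (\<lambda>n. norm (f (e n) y))"
       "summable (\<lambda>n. \<integral>y. norm (f (e n) y) \<partial>lborel)"
      using series(2)[OF sum1] e\<Gamma> Jle
      by (auto intro!: summable_comparison_test'[OF sumB])
    show ?thesis
      unfolding series(1)[OF sum1] series(1)[OF sum2]
      using integrable_suminf[OF int[OF e\<Gamma>] *] integral_suminf[OF int[OF e\<Gamma>] *] by auto
  qed
  then show "integrable lborel (\<lambda>y. \<Sum>\<^sub>\<infinity>g\<in>\<Gamma>. f g y)"
    "(\<integral>y. (\<Sum>\<^sub>\<infinity>g\<in>\<Gamma>. f g y) \<partial>lborel) = (\<Sum>\<^sub>\<infinity>g\<in>\<Gamma>. \<integral>y. f g y \<partial>lborel)" by auto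
qed

section \<open>Gaussians\<close>

text \<open>Polynomial functions, in a form closed under directional derivatives; they are the
  factors that differentiation puts in front of a Gaussian.\<close>

inductive poly_fun :: "('a::euclidean_space \<Rightarrow> complex) \<Rightarrow> bool" where
  poly_fun_const: "poly_fun (\<lambda>_. c)"
| poly_fun_inner: "poly_fun (\<lambda>y. of_real (y \<bullet> v))"
| poly_fun_add: "poly_fun p \<Longrightarrow> poly_fun q \<Longrightarrow> poly_fun (\<lambda>y. p y + q y)"
| poly_fun_mult: "poly_fun p \<Longrightarrow> poly_fun q \<Longrightarrow> poly_fun (\<lambda>y. p y * q y)"

lemma poly_fun_derivative:
  assumes "poly_fun p"
  shows "\<exists>p'. (\<forall>y. (p has_derivative p' y) (at y)) \<and> (\<forall>v. poly_fun (\<lambda>y. p' y v))"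
  using assms
proof induction
  case (poly_fun_const c)
  show ?case using poly_fun.poly_fun_const[of 0] by (intro exI[of _ "\<lambda>_ _. 0"]) auto
next
  case (poly_fun_inner v)
  have "((\<lambda>y. complex_of_real (y \<bullet> v)) has_derivative (\<lambda>z. of_real (z \<bullet> v))) (at y)" for y
    by (auto intro!: derivative_eq_intros)
  then show ?case using poly_fun.poly_fun_const by (intro exI[of _ "\<lambda>_ z. of_real (z \<bullet> v)"]) auto
next
  case (poly_fun_add p q)
  then obtain p' q' where "\<And>y. (p has_derivative p' y) (at y)" "\<And>v. poly_fun (\<lambda>y. p' y v)"
    "\<And>y. (q has_derivative q' y) (at y)" "\<And>v. poly_fun (\<lambda>y. q' y v)" by blast
  then show ?case
    by (intro exI[of _ "\<lambda>y v. p' y v + q' y v"])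
       (auto intro!: poly_fun.poly_fun_add has_derivative_add)
next
  case (poly_fun_mult p q)
  then obtain p' q' where "\<And>y. (p has_derivative p' y) (at y)" "\<And>v. poly_fun (\<lambda>y. p' y v)"
    "\<And>y. (q has_derivative q' y) (at y)" "\<And>v. poly_fun (\<lambda>y. q' y v)" by blast
  then show ?case using poly_fun_mult.hyps
    by (intro exI[of _ "\<lambda>y v. p y * q' y v + p' y v * q y"])
       (auto intro!: poly_fun.poly_fun_add poly_fun.poly_fun_mult has_derivative_mult)
qed

lemma poly_fun_growth:
  assumes "poly_fun p"
  shows "\<exists>C N. 0 \<le> C \<and> (\<forall>y. norm (p y) \<le> C * (1 + norm y) ^ N)"
  using assms
proof induction
  case (poly_fun_const c)
  show ?case by (intro exI[of _ "norm c"] exI[of _ 0]) auto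
next
  case (poly_fun_inner v)
  have "norm (complex_of_real (y \<bullet> v)) \<le> norm v * (1 + norm y) ^ 1" for y
  proof -
    have "\<bar>y \<bullet> v\<bar> \<le> norm y * norm v" by (rule Cauchy_Schwarz_ineq2)
    also have "\<dots> \<le> norm v * (1 + norm y)" by (simp add: algebra_simps)
    finally show ?thesis by simp
  qed
  then show ?case using norm_ge_zero by blast
next
  case (poly_fun_add p q)
  then obtain C N D M where *: "C \<ge> 0" "D \<ge> 0" "\<And>y. norm (p y) \<le> C * (1 + norm y) ^ N" "\<And>y. norm (q y) \<le> D * (1 + norm y) ^ M"
    by blast
  have "norm (p y + q y) \<le> (C + D) * (1 + norm y) ^ (N + M)" for y
  proof -
    have "norm (p y + q y) \<le> C * (1 + norm y) ^ N + D * (1 + norm y) ^ M"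
      using * by (intro norm_triangle_mono) auto
    also have "\<dots> \<le> C * (1 + norm y) ^ (N + M) + D * (1 + norm y) ^ (N + M)"
      using * by (intro add_mono mult_left_mono power_increasing) auto
    finally show ?thesis by (simp add: ring_distribs)
  qed
  then show ?case using * by (intro exI[of _ "C + D"] exI[of _ "N + M"]) auto
next
  case (poly_fun_mult p q)
  then obtain C N D M where *: "C \<ge> 0" "D \<ge> 0" "\<And>y. norm (p y) \<le> C * (1 + norm y) ^ N" "\<And>y. norm (q y) \<le> D * (1 + norm y) ^ M"
    by blast
  have "norm (p y * q y) \<le> (C * D) * (1 + norm y) ^ (N + M)" for y
  proof -
    have "norm (p y) * norm (q y) \<le> (C * (1 + norm y) ^ N) * (D * (1 + norm y) ^ M)"
      using * by (intro mult_mono) auto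
    then show ?thesis by (simp add: norm_mult power_add mult_ac)
  qed
  then show ?case using * by (intro exI[of _ "C * D"] exI[of _ "N + M"]) auto
qed

text \<open>The modulation by \<open>\<xi>\<close> moves the centre of the Fourier transform to
  \<open>\<xi>\<close>.\<close>

definition gauss :: "real \<Rightarrow> 'a::euclidean_space \<Rightarrow> 'a \<Rightarrow> complex" where
  "gauss a \<xi> y = of_real (exp (- (a * (y \<bullet> y)))) * chr \<xi> y"

lemma gauss_exp: "gauss a \<xi> y = exp (of_real (- (a * (y \<bullet> y))) + \<i> * of_real (2 * pi * (y \<bullet> \<xi>)))"
  by (simp only: gauss_def chr_def exp_add cis_conv_exp exp_of_real)

lemma gauss_has_derivative:
  "(gauss a \<xi> has_derivative (\<lambda>v. gauss a \<xi> y * (of_real (- 2 * a) * of_real (y \<bullet> v) + \<i> * of_real (2 * pi * (v \<bullet> \<xi>))))) (at y)"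
proof -
  let ?e = "\<lambda>y. complex_of_real (- (a * (y \<bullet> y))) + \<i> * of_real (2 * pi * (y \<bullet> \<xi>))"
  have "(?e has_derivative (\<lambda>v. of_real (- (a * (2 * (y \<bullet> v)))) + \<i> * of_real (2 * pi * (v \<bullet> \<xi>)))) (at y)"
    by (auto intro!: derivative_eq_intros simp: inner_commute)
  moreover have "(exp has_derivative (*) (exp (?e y))) (at (?e y))"
    using DERIV_exp[of "?e y"] by (simp add: has_field_derivative_def)
  ultimately have "((\<lambda>y. exp (?e y)) has_derivative (\<lambda>v. exp (?e y) * (of_real (- (a * (2 * (y \<bullet> v)))) + \<i> * of_real (2 * pi * (v \<bullet> \<xi>))))) (at y)"
    by (rule has_derivative_compose)
  then show ?thesis by (simp add: gauss_exp[abs_def] mult_ac)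
qed

lemma power_times_gaussian_bounded:
  fixes a :: real
  assumes "a > 0"
  obtains C where "\<And>r. r \<ge> 0 \<Longrightarrow> (1 + r) ^ N * exp (- (a * r\<^sup>2)) \<le> C"
proof -
  let ?f = "\<lambda>r::real. (1 + r) ^ N * exp (- (a * r\<^sup>2))"
  have "(?f \<longlongrightarrow> 0) at_top"
  proof (rule tendsto_sandwich[OF _ _ tendsto_const])
    have "((\<lambda>x::real. exp (a + 1) * ((1 + x) ^ N / exp (1 + x))) \<longlongrightarrow> exp (a + 1) * 0) at_top"
      by (intro tendsto_intros filterlim_compose[OF tendsto_power_div_exp_0] filterlim_tendsto_add_at_top[OF tendsto_const filterlim_ident])
    then show "((\<lambda>x::real. exp (a + 1) * ((1 + x) ^ N / exp (1 + x))) \<longlongrightarrow> 0) at_top" by simp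
    show "\<forall>\<^sub>F r in at_top. ?f r \<le> exp (a + 1) * ((1 + r) ^ N / exp (1 + r))"
      using eventually_ge_at_top[of "max 1 (1 / a)"]
    proof eventually_elim
      case (elim r)
      \<comment> \<open>For r beyond 1 / a the exponent a r^2 dominates r, which reduces the decay
        to that of a power over an exponential.\<close>
      then have "r * 1 \<le> r * (a * r)" using assms by (intro mult_left_mono) (auto simp: field_simps)
      then have "exp (- (a * r\<^sup>2)) \<le> exp ((a + 1) - (1 + r))"
        using assms by (simp add: power2_eq_square mult_ac)
      then have "?f r \<le> (1 + r) ^ N * exp ((a + 1) - (1 + r))"
        using elim by (intro mult_left_mono) auto
      also have "\<dots> = exp (a + 1) * ((1 + r) ^ N / exp (1 + r))"
        by (simp only: exp_diff times_divide_eq_right mult.commute)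
      finally show ?case .
    qed
    show "\<forall>\<^sub>F r in at_top. 0 \<le> ?f r"
      using eventually_ge_at_top[of 0] by eventually_elim auto
  qed
  then have "\<forall>\<^sub>F r in at_top. ?f r < 1" by (rule order_tendstoD) simp
  then obtain R where R: "\<And>r. r \<ge> R \<Longrightarrow> ?f r < 1" by (auto simp: eventually_at_top_linorder)
  have "?f r \<le> 1 + (1 + \<bar>R\<bar>) ^ N" if "r \<ge> 0" for r
  proof (cases "r \<ge> R")
    case True
    then show ?thesis using R[of r] by (smt (verit) zero_le_power)
  next
    case False
    then have "(1 + r) ^ N * exp (- (a * r\<^sup>2)) \<le> (1 + \<bar>R\<bar>) ^ N * 1"
      using that assms by (intro mult_mono power_mono) auto
    then show ?thesis by simp
  qed
  then show ?thesis using that by blast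
qed

text \<open>Every iterated partial derivative is the Gaussian times a polynomial function, and the
  Gaussian absorbs polynomial growth.\<close>

lemma schwartz_gauss:
  assumes "a > 0"
  shows "schwartz (gauss a \<xi>)"
proof -
  have *: "\<exists>p. poly_fun p \<and> pderivs vs (gauss a \<xi>) = (\<lambda>y. gauss a \<xi> y * p y)" for vs
  proof (induction vs)
    case Nil
    show ?case using poly_fun_const[of 1] by auto
  next
    case (Cons v vs)
    then obtain p where p: "poly_fun p" "pderivs vs (gauss a \<xi>) = (\<lambda>y. gauss a \<xi> y * p y)" by blast
    obtain p' where p': "\<And>y. (p has_derivative p' y) (at y)" "\<And>v. poly_fun (\<lambda>y. p' y v)"
      using poly_fun_derivative[OF p(1)] by blast
    let ?q = "\<lambda>y. p' y v + (of_real (- 2 * a) * of_real (y \<bullet> v) + \<i> * of_real (2 * pi * (v \<bullet> \<xi>))) * p y"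
    have "frechet_derivative (pderivs vs (gauss a \<xi>)) (at y) v = gauss a \<xi> y * ?q y" for y
      unfolding p(2) frechet_derivative_at[OF has_derivative_mult[OF gauss_has_derivative p'(1)], symmetric]
      by (simp add: algebra_simps)
    moreover have "poly_fun ?q"
      by (intro poly_fun.intros p p')
    ultimately show ?case by (intro exI[of _ ?q]) auto
  qed
  show ?thesis
    unfolding schwartz_def
  proof (intro conjI allI impI)
    fix vs :: "'a list" and x
    obtain p where p: "poly_fun p" "pderivs vs (gauss a \<xi>) = (\<lambda>y. gauss a \<xi> y * p y)" using * by blast
    obtain p' where p': "\<And>y. (p has_derivative p' y) (at y)"
      using poly_fun_derivative[OF p(1)] by blast
    show "pderivs vs (gauss a \<xi>) differentiable at x"
      unfolding p(2) differentiable_def using has_derivative_mult[OF gauss_has_derivative p'] by blast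
  next
    fix vs :: "'a list" and N
    obtain p where p: "poly_fun p" "pderivs vs (gauss a \<xi>) = (\<lambda>y. gauss a \<xi> y * p y)" using * by blast
    obtain C M where C: "C \<ge> 0" "\<And>y. norm (p y) \<le> C * (1 + norm y) ^ M" using poly_fun_growth[OF p(1)] by blast
    obtain B where B: "\<And>r. r \<ge> 0 \<Longrightarrow> (1 + r) ^ (N + M) * exp (- (a * r\<^sup>2)) \<le> B"
      using power_times_gaussian_bounded[OF assms] by blast
    show "bounded (range (\<lambda>x. (1 + norm x) ^ N * norm (pderivs vs (gauss a \<xi>) x)))"
    proof (rule boundedI)
      fix z assume "z \<in> range (\<lambda>x. (1 + norm x) ^ N * norm (pderivs vs (gauss a \<xi>) x))"
      then obtain x where z: "z = (1 + norm x) ^ N * norm (pderivs vs (gauss a \<xi>) x)" by blast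
      have "norm z = (1 + norm x) ^ N * (exp (- (a * (norm x)\<^sup>2)) * norm (p x))"
        by (simp add: z p(2) gauss_def norm_mult dot_square_norm)
      also have "\<dots> \<le> (1 + norm x) ^ N * (exp (- (a * (norm x)\<^sup>2)) * (C * (1 + norm x) ^ M))"
        using C by (intro mult_left_mono) auto
      also have "\<dots> = C * ((1 + norm x) ^ (N + M) * exp (- (a * (norm x)\<^sup>2)))"
        by (simp add: power_add mult_ac)
      also have "\<dots> \<le> C * B" using B[of "norm x"] C by (intro mult_left_mono) auto
      finally show "norm z \<le> C * B" .
    qed
  qed
qed

text \<open>Rescaling t by 1 / s turns the integrand into the standard normal density times a
  character, whose integral is the known characteristic function.\<close>

lemma
  assumes "s > 0"
  shows integrable_gaussian_cis: "integrable lborel (\<lambda>t. of_real (exp (- (s\<^sup>2 / 2 * t\<^sup>2))) * cis (u * t))"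
    and integral_gaussian_cis: "(\<integral>t. of_real (exp (- (s\<^sup>2 / 2 * t\<^sup>2))) * cis (u * t) \<partial>lborel)
       = of_real (sqrt (2 * pi) / s * exp (- ((u / s)\<^sup>2 / 2)))"
proof -
  let ?f = "\<lambda>t. of_real (exp (- (s\<^sup>2 / 2 * t\<^sup>2))) * cis (u * t)"
  have eq: "?f (0 + 1 / s * t) = of_real (sqrt (2 * pi)) * (std_normal_density t *\<^sub>R iexp (u / s * t))" for t
    using assms by (simp add: std_normal_density_def cis_conv_exp power_divide scaleR_conv_of_real)
  have int: "integrable lborel (\<lambda>t. std_normal_density t *\<^sub>R iexp (v * t))" for v
    by (rule Bochner_Integration.integrable_bound[OF integrable_normal_density[of 1 0]])
       (auto intro!: AE_I2)
  have "integrable lborel (\<lambda>t. ?f (0 + 1 / s * t))"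
    unfolding eq by (intro integrable_mult_right int)
  then show "integrable lborel ?f"
    using assms by (subst (asm) lborel_integrable_real_affine_iff) auto
  have "(\<integral>t. std_normal_density t *\<^sub>R iexp (v * t) \<partial>lborel) = of_real (exp (- v\<^sup>2 / 2))" for v
  proof -
    have "(\<integral>t. std_normal_density t *\<^sub>R iexp (v * t) \<partial>lborel) = char std_normal_distribution v"
      unfolding char_def by (subst integral_density) auto
    then show ?thesis by (simp add: char_std_normal_distribution)
  qed
  then have "(\<integral>t. ?f (0 + 1 / s * t) \<partial>lborel) = of_real (sqrt (2 * pi) * exp (- (u / s)\<^sup>2 / 2))"
    by (simp only: eq integral_mult_right_zero of_real_mult minus_divide_left)
  moreover have "(\<integral>t. ?f t \<partial>lborel) = \<bar>1 / s\<bar> *\<^sub>R (\<integral>t. ?f (0 + 1 / s * t) \<partial>lborel)"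
    using assms by (intro lborel_integral_real_affine) auto
  ultimately show "(\<integral>t. ?f t \<partial>lborel) = of_real (sqrt (2 * pi) / s * exp (- ((u / s)\<^sup>2 / 2)))"
    using assms by (simp add: scaleR_conv_of_real)
qed

lemma inner_self_sum: "(y::'a::euclidean_space) \<bullet> y = (\<Sum>i\<in>Basis. (y \<bullet> i)\<^sup>2)"
  by (subst euclidean_inner) (simp add: power2_eq_square)

lemma chr_prod: "chr w (y::'a::euclidean_space) = (\<Prod>i\<in>Basis. cis (2 * pi * (w \<bullet> i) * (y \<bullet> i)))"
proof -
  have "\<i> * of_real (2 * pi * (y \<bullet> w)) = (\<Sum>i\<in>Basis. \<i> * of_real (2 * pi * (w \<bullet> i) * (y \<bullet> i)))"
    by (subst euclidean_inner) (simp add: sum_distrib_left mult_ac)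
  then show ?thesis by (simp add: chr_def cis_conv_exp exp_sum)
qed

text \<open>Fourier transform of the unmodulated Gaussian with parameter s^2 / 2: a Gaussian of
  total mass 1 that concentrates at the origin as s tends to 0. The product form lets integrals
  factor over the coordinates.\<close>

definition gkern :: "real \<Rightarrow> 'a::euclidean_space \<Rightarrow> real" where
  "gkern s z = (\<Prod>i\<in>Basis. sqrt (2 * pi) / s * exp (- ((2 * pi * (z \<bullet> i) / s)\<^sup>2 / 2)))"

lemma gkern_alt: "gkern s (z::'a::euclidean_space) = (sqrt (2 * pi) / s) ^ DIM('a) * exp (- (2 * pi\<^sup>2 / s\<^sup>2 * (z \<bullet> z)))"
proof -
  have "gkern s z = (sqrt (2 * pi) / s) ^ DIM('a) * exp (\<Sum>i\<in>Basis. - ((2 * pi * (z \<bullet> i) / s)\<^sup>2 / 2))"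
    unfolding gkern_def by (simp only: prod.distrib prod_constant exp_sum[OF finite_Basis])
  also have "(\<Sum>i\<in>Basis. - ((2 * pi * (z \<bullet> i) / s)\<^sup>2 / 2)) = - (2 * pi\<^sup>2 / s\<^sup>2 * (z \<bullet> z))"
    by (simp add: inner_self_sum sum_distrib_left sum_negf power_divide power_mult_distrib mult.assoc)
  finally show ?thesis .
qed

lemma fourier_transform_gauss:
  assumes "s > 0"
  shows "fourier_transform (gauss (s\<^sup>2 / 2) \<xi>) l = of_real (gkern s (\<xi> - l))"
proof -
  have "gauss (s\<^sup>2 / 2) \<xi> x * cis (- 2 * pi * (x \<bullet> l)) =
      (\<Prod>i\<in>Basis. of_real (exp (- (s\<^sup>2 / 2 * (x \<bullet> i)\<^sup>2))) * cis (2 * pi * ((\<xi> - l) \<bullet> i) * (x \<bullet> i)))" for x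
  proof -
    have "gauss (s\<^sup>2 / 2) \<xi> x * cis (- 2 * pi * (x \<bullet> l)) = of_real (exp (- (s\<^sup>2 / 2 * (x \<bullet> x)))) * chr (\<xi> - l) x"
      by (simp add: gauss_def chr_def cis_mult inner_diff_right algebra_simps)
    also have "- (s\<^sup>2 / 2 * (x \<bullet> x)) = (\<Sum>i\<in>Basis. - (s\<^sup>2 / 2 * (x \<bullet> i)\<^sup>2))"
      by (simp only: inner_self_sum sum_distrib_left sum_negf)
    finally show ?thesis
      by (simp only: exp_sum[OF finite_Basis] of_real_prod chr_prod prod.distrib)
  qed
  then have "fourier_transform (gauss (s\<^sup>2 / 2) \<xi>) l =
      (\<integral>x. (\<Prod>i\<in>Basis. of_real (exp (- (s\<^sup>2 / 2 * (x \<bullet> i)\<^sup>2))) * cis (2 * pi * ((\<xi> - l) \<bullet> i) * (x \<bullet> i))) \<partial>lborel)"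
    by (simp only: fourier_transform_def)
  also have "\<dots> = (\<Prod>i\<in>Basis. \<integral>t. of_real (exp (- (s\<^sup>2 / 2 * t\<^sup>2))) * cis (2 * pi * ((\<xi> - l) \<bullet> i) * t) \<partial>lborel)"
    by (intro integral_lborel_prod integrable_gaussian_cis assms)
  also have "\<dots> = of_real (gkern s (\<xi> - l))"
    by (simp only: integral_gaussian_cis[OF assms] gkern_def of_real_prod)
  finally show ?thesis .
qed

section \<open>A band-limited kernel\<close>

lemma borel_measurable_cis [measurable]: "cis \<in> borel_measurable borel"
  unfolding cis_conv_exp[abs_def] by (intro borel_measurable_continuous_onI continuous_intros)

definition tent :: "real \<Rightarrow> real \<Rightarrow> real" where
  "tent \<eta> t = max 0 (\<eta> - \<bar>t\<bar>)"

lemma tent_bounds: "0 \<le> tent \<eta> t" "0 \<le> \<eta> \<Longrightarrow> tent \<eta> t \<le> \<eta>"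
  by (auto simp: tent_def)

lemma borel_measurable_tent [measurable]: "tent \<eta> \<in> borel_measurable borel"
  unfolding tent_def[abs_def] by measurable

lemma integrable_tent_mult:
  fixes f :: "real \<Rightarrow> complex"
  assumes "0 \<le> \<eta>" "f \<in> borel_measurable borel" "\<And>t. norm (f t) \<le> B"
  shows "integrable lborel (\<lambda>t. of_real (tent \<eta> t) * f t)"
proof (rule Bochner_Integration.integrable_bound)
  show "integrable lborel (\<lambda>t. \<eta> * B * indicator {-\<eta>..\<eta>} t)"
    by (intro integrable_mult_right integrable_real_indicator) (auto simp: emeasure_lborel_Icc_eq)
  have "B \<ge> 0" using assms(3) norm_ge_zero order_trans by blast
  have "norm (of_real (tent \<eta> t) * f t) \<le> norm (\<eta> * B * indicator {-\<eta>..\<eta>} t)" for t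
  proof (cases "t \<in> {-\<eta>..\<eta>}")
    case True
    then show ?thesis
      using tent_bounds[of \<eta> t] assms \<open>B \<ge> 0\<close> by (simp add: norm_mult mult_mono)
  next
    case False
    then have "tent \<eta> t = 0" by (auto simp: tent_def)
    then show ?thesis by simp
  qed
  then show "AE t in lborel. norm (of_real (tent \<eta> t) * f t) \<le> norm (\<eta> * B * indicator {-\<eta>..\<eta>} t)"
    by simp
qed (use assms in measurable)

text \<open>The Fejer kernel: for t different from 0 it equals (sin (pi t eta) / (pi t))^2.\<close>

definition fejer :: "real \<Rightarrow> real \<Rightarrow> complex" where
  "fejer \<eta> t = (\<integral>u. of_real (tent \<eta> u) * cis (2 * pi * t * u) \<partial>lborel)"

lemma integrable_tent_cis:
  "0 \<le> \<eta> \<Longrightarrow> integrable lborel (\<lambda>u. of_real (tent \<eta> u) * cis (2 * pi * t * u))"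
  by (rule integrable_tent_mult[where B = 1]) auto

lemma fejer_eq:
  assumes "0 \<le> \<eta>" "t \<noteq> 0"
  shows "fejer \<eta> t = (cis (2 * pi * t * \<eta>) + cis (- (2 * pi * t * \<eta>)) - 2) / (\<i> * of_real (2 * pi * t))\<^sup>2"
proof -
  define a where "a = 2 * pi * t"
  have "a \<noteq> 0" using assms by (simp add: a_def)
  let ?b = "\<i> * complex_of_real a"
  have b: "?b \<noteq> 0" using \<open>a \<noteq> 0\<close> by simp
  have e: "((\<lambda>u. exp (?b * of_real u)) has_vector_derivative ?b * exp (?b * of_real u)) (at u within S)" for u S
    by (rule has_vector_derivative_real_field) (auto intro!: derivative_eq_intros)
  have cont: "continuous_on S (\<lambda>u. of_real (\<eta> + r * u) * exp (?b * of_real u))" for r S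
    by (intro continuous_intros)
  \<comment> \<open>The antiderivative comes from one integration by parts; the slope r is 1 on the
    left half of the tent and -1 on the right.\<close>
  have F: "((\<lambda>u. of_real (\<eta> + r * u) * exp (?b * of_real u) / ?b - of_real r * exp (?b * of_real u) / ?b\<^sup>2) has_vector_derivative
      of_real (\<eta> + r * u) * exp (?b * of_real u)) (at u within S)" for r u S
  proof -
    have "((\<lambda>z. (of_real \<eta> + of_real r * z) * exp (b * z) / b - of_real r * exp (b * z) / b\<^sup>2) has_field_derivative
      (of_real \<eta> + of_real r * z) * exp (b * z)) (at z)" if "b \<noteq> 0" for b z :: complex
      using that by (auto intro!: derivative_eq_intros simp: field_simps power2_eq_square)
    from has_vector_derivative_real_field[OF this[OF b], of u S] show ?thesis by simp
  qed
  note L = has_bochner_integral_FTC_Icc[OF _ F[of 1] cont[of _ 1], of "-\<eta>" 0]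
  note R = has_bochner_integral_FTC_Icc[OF _ F[of "-1"] cont[of _ "-1"], of 0 \<eta>]
  have "fejer \<eta> t = (\<integral>u. indicator {-\<eta>..0} u *\<^sub>R (of_real (\<eta> + 1 * u) * exp (?b * of_real u))
      + indicator {0..\<eta>} u *\<^sub>R (of_real (\<eta> + - 1 * u) * exp (?b * of_real u)) \<partial>lborel)"
    unfolding fejer_def
  proof (rule integral_cong_AE)
    \<comment> \<open>Both indicators contain 0, where the integrand is counted twice; this is a
      null set.\<close>
    have "AE u in lborel. u \<noteq> (0::real)" by (rule AE_lborel_singleton)
    then show "AE u in lborel. of_real (tent \<eta> u) * cis (2 * pi * t * u) = indicator {-\<eta>..0} u *\<^sub>R (of_real (\<eta> + 1 * u) * exp (?b * of_real u))
      + indicator {0..\<eta>} u *\<^sub>R (of_real (\<eta> + - 1 * u) * exp (?b * of_real u))"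
    proof eventually_elim
      case (elim u)
      have "cis (2 * pi * t * u) = exp (?b * of_real u)"
        by (simp add: cis_conv_exp a_def mult_ac)
      then show ?case using elim \<open>0 \<le> \<eta>\<close>
        by (auto simp: tent_def max_def abs_if split: split_indicator)
    qed
  qed (measurable)
  also have "\<dots> = (of_real (\<eta> + 1 * 0) * exp (?b * of_real 0) / ?b - of_real 1 * exp (?b * of_real 0) / ?b\<^sup>2)
     - (of_real (\<eta> + 1 * (-\<eta>)) * exp (?b * of_real (-\<eta>)) / ?b - of_real 1 * exp (?b * of_real (-\<eta>)) / ?b\<^sup>2)
     + ((of_real (\<eta> + - 1 * \<eta>) * exp (?b * of_real \<eta>) / ?b - of_real (- 1) * exp (?b * of_real \<eta>) / ?b\<^sup>2)
     - (of_real (\<eta> + - 1 * 0) * exp (?b * of_real 0) / ?b - of_real (- 1) * exp (?b * of_real 0) / ?b\<^sup>2))"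
    using assms by (intro has_bochner_integral_integral_eq has_bochner_integral_add L R) auto
  also have "\<dots> = (exp (?b * of_real \<eta>) + exp (?b * of_real (-\<eta>)) - 2) / ?b\<^sup>2"
    using b by (simp add: diff_divide_distrib add_divide_distrib)
  also have "exp (?b * of_real \<eta>) = cis (a * \<eta>)" by (simp add: cis_conv_exp mult_ac)
  also have "exp (?b * of_real (-\<eta>)) = cis (- (a * \<eta>))" by (simp add: cis_conv_exp mult_ac)
  finally show ?thesis by (simp only: a_def)
qed

text \<open>The integral of the tent bounds the kernel near 0, the closed form gives at most 1 / t^2
  elsewhere; the two bounds add up to J + 1 after multiplication by 1 + t^2.\<close>

lemma fejer_decay:
  assumes "0 \<le> \<eta>"
  obtains C where "\<And>t. norm (fejer \<eta> t) \<le> C * (1 / (1 + t\<^sup>2))" "C \<ge> 0"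
proof -
  define J where "J = (\<integral>u. tent \<eta> u \<partial>lborel)"
  have "J \<ge> 0" by (simp add: J_def tent_bounds)
  have J: "norm (fejer \<eta> t) \<le> J" for t
    unfolding fejer_def J_def
    using integral_norm_bound[of lborel "\<lambda>u. of_real (tent \<eta> u) * cis (2 * pi * t * u)"]
    by (simp add: norm_mult tent_bounds)
  have far: "norm (fejer \<eta> t) * t\<^sup>2 \<le> 1" for t
  proof (cases "t = 0")
    case False
    have "norm (cis (2 * pi * t * \<eta>) + cis (- (2 * pi * t * \<eta>)) - 2) \<le> (1 + 1) + 2"
      by (intro order_trans[OF norm_triangle_ineq4] add_mono order_trans[OF norm_triangle_ineq]) auto
    then have "norm (fejer \<eta> t) \<le> 4 / (2 * pi * \<bar>t\<bar>)\<^sup>2"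
      unfolding fejer_eq[OF assms False] norm_divide
      by (intro frac_le) (use False in \<open>auto simp: norm_mult norm_power\<close>)
    also have "\<dots> = (1 / pi\<^sup>2) / t\<^sup>2" by (simp add: power_mult_distrib)
    also have "\<dots> \<le> 1 / t\<^sup>2"
    proof (intro divide_right_mono)
      have "1 \<le> pi\<^sup>2" using pi_gt3 by (intro one_le_power) linarith
      then show "1 / pi\<^sup>2 \<le> 1" by simp
    qed simp
    finally show ?thesis using False by (simp add: field_simps)
  qed simp
  have "norm (fejer \<eta> t) \<le> (J + 1) * (1 / (1 + t\<^sup>2))" for t
  proof -
    have "norm (fejer \<eta> t) * (1 + t\<^sup>2) \<le> J + 1" using J[of t] far[of t] by (simp add: algebra_simps)
    then show ?thesis by (simp add: pos_le_divide_eq)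
  qed
  then show ?thesis using that \<open>J \<ge> 0\<close> by (metis add_nonneg_nonneg zero_le_one)
qed

definition box_tent :: "real \<Rightarrow> 'a::euclidean_space \<Rightarrow> real" where
  "box_tent \<eta> z = (\<Prod>i\<in>Basis. tent \<eta> (z \<bullet> i))"

text \<open>The kernel psi of the overview. Its frequencies lie in a cube of half-side
  \<open>\<eta>\<close>.\<close>

definition band_kernel :: "real \<Rightarrow> 'a::euclidean_space \<Rightarrow> complex" where
  "band_kernel \<eta> y = (\<integral>z. of_real (box_tent \<eta> z) * chr z y \<partial>lborel)"

lemma chr_commute: "chr w y = chr y w"
  by (simp add: chr_def inner_commute)

lemma box_tent_nonneg: "0 \<le> box_tent \<eta> z"
  by (auto simp: box_tent_def tent_bounds intro!: prod_nonneg)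

lemma borel_measurable_box_tent [measurable]: "box_tent \<eta> \<in> borel_measurable borel"
  unfolding box_tent_def[abs_def] by measurable

lemma integrable_box_tent:
  assumes "0 \<le> \<eta>"
  shows "integrable lborel (box_tent \<eta> :: 'a::euclidean_space \<Rightarrow> real)"
proof -
  have "integrable lborel (\<lambda>z::'a. \<Prod>i\<in>Basis. complex_of_real (tent \<eta> (z \<bullet> i)) * cis (2 * pi * 0 * (z \<bullet> i)))"
    using assms by (intro integrable_lborel_prod integrable_tent_cis)
  then have "integrable lborel (\<lambda>z::'a. complex_of_real (box_tent \<eta> z))"
    by (simp add: box_tent_def)
  then show ?thesis by (simp only: complex_of_real_integrable_eq)
qed

lemma chr_prod': "chr w (y::'a::euclidean_space) = (\<Prod>i\<in>Basis. cis (2 * pi * (y \<bullet> i) * (w \<bullet> i)))"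
  by (rule trans[OF chr_commute chr_prod])

text \<open>The Euclidean norm is at most the sum of the coordinates' absolute values; this fixes
  how \<open>\<eta>\<close> must depend on the dimension for the cube to fit into a ball.\<close>

lemma norm_le_of_box_tent:
  fixes \<eta> :: real
  assumes "box_tent \<eta> z \<noteq> 0"
  shows "norm (z::'a::euclidean_space) \<le> DIM('a) * \<eta>"
proof -
  have "\<bar>z \<bullet> i\<bar> \<le> \<eta>" if "i \<in> Basis" for i
    using assms that by (auto simp: box_tent_def tent_def max_def split: if_splits)
  then have "(\<Sum>i\<in>Basis. \<bar>z \<bullet> i\<bar>) \<le> DIM('a) * \<eta>"
    by (intro sum_bounded_above)
  then show ?thesis using norm_le_l1[of z] by linarith
qed

lemma band_kernel_prod:
  assumes "0 \<le> \<eta>"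
  shows "band_kernel \<eta> (y::'a::euclidean_space) = (\<Prod>i\<in>Basis. fejer \<eta> (y \<bullet> i))"
proof -
  have "of_real (box_tent \<eta> z) * chr z y = (\<Prod>i\<in>Basis. of_real (tent \<eta> (z \<bullet> i)) * cis (2 * pi * (y \<bullet> i) * (z \<bullet> i)))" for z :: 'a
    by (simp only: chr_prod' box_tent_def of_real_prod prod.distrib)
  then show ?thesis
    unfolding band_kernel_def fejer_def using assms
    by (simp only:) (intro integral_lborel_prod integrable_tent_cis)
qed

lemma band_kernel_decay:
  assumes "0 \<le> \<eta>"
  obtains C where "C \<ge> 0" "\<And>y::'a::euclidean_space. norm (band_kernel \<eta> y) \<le> C * pkern y"
proof -
  obtain D where D: "\<And>t. norm (fejer \<eta> t) \<le> D * (1 / (1 + t\<^sup>2))" "D \<ge> 0"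
    using fejer_decay[OF assms] by blast
  have "norm (band_kernel \<eta> y) \<le> D ^ DIM('a) * pkern y" for y :: 'a
  proof -
    have "norm (band_kernel \<eta> y) = (\<Prod>i\<in>Basis. norm (fejer \<eta> (y \<bullet> i)))"
      by (simp only: band_kernel_prod[OF assms] prod_norm)
    also have "\<dots> \<le> (\<Prod>i\<in>Basis. D * (1 / (1 + (y \<bullet> i)\<^sup>2)))"
      using D by (intro prod_mono conjI norm_ge_zero)
    also have "\<dots> = D ^ DIM('a) * pkern y" by (simp only: prod.distrib prod_constant pkern_def)
    finally show ?thesis .
  qed
  then show ?thesis using that D(2) by (metis zero_le_power)
qed

text \<open>The Gaussian factor has mass 1 and concentrates at 0, so the limit is the value of the
  tent there. After rescaling, the normal density is fixed and dominated convergence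
  applies.\<close>

lemma tent_approximate_identity:
  assumes "0 \<le> \<eta>" "\<And>n. 0 < s n" "s \<longlonglongrightarrow> 0"
  shows "(\<lambda>n::nat. \<integral>t. of_real (tent \<eta> t) * (cis (2 * pi * x * t) * of_real (sqrt (2 * pi) / s n * exp (- ((2 * pi * t / s n)\<^sup>2 / 2)))) \<partial>lborel)
     \<longlonglongrightarrow> of_real \<eta>"
proof -
  let ?f = "\<lambda>n t. complex_of_real (tent \<eta> t) * (cis (2 * pi * x * t) * of_real (sqrt (2 * pi) / s n * exp (- ((2 * pi * t / s n)\<^sup>2 / 2))))"
  let ?g = "\<lambda>n u. of_real (std_normal_density u) * (complex_of_real (tent \<eta> (s n / (2 * pi) * u)) * cis (x * s n * u))"
  have "integral\<^sup>L lborel (?f n) = integral\<^sup>L lborel (?g n)" for n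
  proof -
    let ?c = "s n / (2 * pi)"
    have "?c > 0" using assms by simp
    then have "integral\<^sup>L lborel (?f n) = \<bar>?c\<bar> *\<^sub>R (\<integral>u. ?f n (0 + ?c * u) \<partial>lborel)"
      by (intro lborel_integral_real_affine) auto
    also have "\<dots> = (\<integral>u. of_real ?c * ?f n (0 + ?c * u) \<partial>lborel)"
      using \<open>?c > 0\<close> by (simp only: scaleR_conv_of_real abs_of_pos integral_mult_right_zero)
    also have "\<dots> = integral\<^sup>L lborel (?g n)"
    proof (rule Bochner_Integration.integral_cong[OF refl])
      fix u :: real
      have s: "2 * pi * (0 + ?c * u) / s n = u" "2 * pi * x * (0 + ?c * u) = x * s n * u" 
        using assms(2)[of n] by (auto simp: field_simps)
      have A: "?c * (sqrt (2 * pi) / s n * exp (- (u\<^sup>2 / 2))) = std_normal_density u"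
      proof -
        have "?c * (sqrt (2 * pi) / s n) = sqrt (2 * pi) / (2 * pi)" using assms(2)[of n] by simp
        also have "\<dots> = 1 / sqrt (2 * pi)"
        proof -
          have "sqrt y / y = 1 / sqrt y" if "y > 0" for y :: real using that by (simp add: field_simps)
          then show ?thesis by simp
        qed
        finally have "?c * (sqrt (2 * pi) / s n) = 1 / sqrt (2 * pi)" .
        then show ?thesis by (simp only: std_normal_density_def mult.assoc[symmetric] minus_divide_left)
      qed
      have alg: "of_real k * (T * (Z * of_real X)) = of_real (k * X) * (T * Z)" for k X :: real and T Z :: complex
        by simp
      show "of_real ?c * ?f n (0 + ?c * u) = ?g n u" unfolding s by (simp only: alg A add_0_left)
    qed
    finally show ?thesis .
  qed
  moreover have "(\<lambda>n. integral\<^sup>L lborel (?g n)) \<longlonglongrightarrow> (\<integral>u. of_real (std_normal_density u) * of_real \<eta> \<partial>lborel)"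
  proof (rule integral_dominated_convergence)
    show "integrable lborel (\<lambda>u. std_normal_density u * \<eta>)"
      by (intro integrable_mult_left integrable_normal_density) simp
    show "AE u in lborel. norm (?g n u) \<le> std_normal_density u * \<eta>" for n
      using tent_bounds assms(1) by (intro AE_I2) (auto simp: norm_mult intro!: mult_left_mono)
    show "AE u in lborel. (\<lambda>n. ?g n u) \<longlonglongrightarrow> of_real (std_normal_density u) * of_real \<eta>"
    proof (rule AE_I2)
      fix u
      have cis: "isCont cis 0" by (simp add: cis_conv_exp[abs_def] continuous_intros)
      have "(\<lambda>n. tent \<eta> (s n / (2 * pi) * u)) \<longlonglongrightarrow> max 0 (\<eta> - \<bar>0 / (2 * pi) * u\<bar>)"
        unfolding tent_def by (intro tendsto_intros assms) auto
      then have "(\<lambda>n. tent \<eta> (s n / (2 * pi) * u)) \<longlonglongrightarrow> \<eta>" using assms(1) by simp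
      moreover have "(\<lambda>n. x * s n * u) \<longlonglongrightarrow> x * 0 * u" by (intro tendsto_intros assms)
      then have "(\<lambda>n. cis (x * s n * u)) \<longlonglongrightarrow> cis 0"
        using isCont_tendsto_compose[OF cis, of "\<lambda>n. x * s n * u" sequentially] by simp
      ultimately have "(\<lambda>n. ?g n u) \<longlonglongrightarrow> of_real (std_normal_density u) * (of_real \<eta> * cis 0)"
        by (intro tendsto_mult tendsto_const tendsto_of_real)
      then show "(\<lambda>n. ?g n u) \<longlonglongrightarrow> of_real (std_normal_density u) * of_real \<eta>" by simp
    qed
  qed measurable
  moreover have "(\<integral>u. of_real (std_normal_density u) * of_real \<eta> \<partial>lborel) = complex_of_real \<eta>"
    by (simp flip: of_real_mult)
  ultimately show ?thesis by simp
qed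

lemma box_tent_gkern_limit:
  assumes "0 \<le> \<eta>" "\<And>n. 0 < s n" "s \<longlonglongrightarrow> 0"
  shows "(\<lambda>n::nat. \<integral>z. of_real (box_tent \<eta> z) * (chr z x * of_real (gkern (s n) z)) \<partial>lborel)
     \<longlonglongrightarrow> of_real (\<eta> ^ DIM('a::euclidean_space))" (is "(\<lambda>n. ?I n) \<longlonglongrightarrow> _")
    and "integrable lborel (\<lambda>z. of_real (box_tent \<eta> z) * (chr z (x::'a) * of_real (gkern (s n) z)))"
proof -
  let ?f = "\<lambda>n i t. complex_of_real (tent \<eta> t) * (cis (2 * pi * (x \<bullet> i) * t) * of_real (sqrt (2 * pi) / s n * exp (- ((2 * pi * t / s n)\<^sup>2 / 2))))"
  have eq: "of_real (box_tent \<eta> z) * (chr z x * of_real (gkern (s n) z)) = (\<Prod>i\<in>Basis. ?f n i (z \<bullet> i))" for n and z :: 'a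
    unfolding chr_prod' box_tent_def gkern_def of_real_prod by (simp only: prod.distrib)
  have int: "integrable lborel (?f n i)" for n i
  proof (rule integrable_tent_mult[OF assms(1)])
    show "norm (cis (2 * pi * (x \<bullet> i) * t) * of_real (sqrt (2 * pi) / s n * exp (- ((2 * pi * t / s n)\<^sup>2 / 2)))) \<le> sqrt (2 * pi) / s n * 1" for t
      using assms(2)[of n] unfolding norm_mult norm_of_real abs_mult norm_cis mult_1_left
      by (intro mult_mono) auto
  qed measurable
  show "integrable lborel (\<lambda>z. of_real (box_tent \<eta> z) * (chr z x * of_real (gkern (s n) z)))"
    unfolding eq by (intro integrable_lborel_prod int)
  have "?I n = (\<Prod>i\<in>Basis. integral\<^sup>L lborel (?f n i))" for n
    unfolding eq by (intro integral_lborel_prod int)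
  moreover have "(\<lambda>n. \<Prod>i\<in>(Basis::'a set). integral\<^sup>L lborel (?f n i)) \<longlonglongrightarrow> (\<Prod>i\<in>(Basis::'a set). of_real \<eta>)"
    by (intro tendsto_prod tent_approximate_identity assms)
  ultimately show "?I \<longlonglongrightarrow> of_real (\<eta> ^ DIM('a))" by simp
qed

text \<open>In one coordinate a (1 + t^2) <= 1 + a t^2 <= exp (a t^2), where a <= 1 enters. Sums of
  Gaussians over the atoms are thereby controlled by sums of \<open>pkern\<close>.\<close>

lemma exp_le_pkern:
  assumes "0 < a" "a \<le> 1"
  shows "exp (- (a * (y \<bullet> y))) \<le> (1 / a) ^ DIM('a) * pkern (y::'a::euclidean_space)"
proof -
  have "exp (- (a * t\<^sup>2)) \<le> 1 / a * (1 / (1 + t\<^sup>2))" for t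
  proof -
    have "a * (1 + t\<^sup>2) \<le> 1 + a * t\<^sup>2" using assms by (simp add: algebra_simps)
    also have "\<dots> \<le> exp (a * t\<^sup>2)" by (rule exp_ge_add_one_self)
    finally have le: "a * (1 + t\<^sup>2) \<le> exp (a * t\<^sup>2)" .
    have "exp (- (a * t\<^sup>2)) = 1 / exp (a * t\<^sup>2)" by (simp only: exp_minus inverse_eq_divide)
    also have "\<dots> \<le> 1 / (a * (1 + t\<^sup>2))"
      using le assms by (intro frac_le) auto
    finally show ?thesis by simp
  qed
  then have "(\<Prod>i\<in>(Basis::'a set). exp (- (a * (y \<bullet> i)\<^sup>2))) \<le> (\<Prod>i\<in>Basis. 1 / a * (1 / (1 + (y \<bullet> i)\<^sup>2)))"
    by (intro prod_mono) auto
  also have "\<dots> = (1 / a) ^ DIM('a) * pkern y" by (simp only: prod.distrib prod_constant pkern_def)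
  also have "(\<Prod>i\<in>(Basis::'a set). exp (- (a * (y \<bullet> i)\<^sup>2))) = exp (- (a * (y \<bullet> y)))"
    by (simp add: inner_self_sum sum_distrib_left exp_sum sum_negf[symmetric])
  finally show ?thesis .
qed

section \<open>Recovering atoms and the main estimate\<close>

lemma sum_infsum_swap:
  fixes g :: "'i \<Rightarrow> 'b \<Rightarrow> 'c::banach"
  assumes "finite F" "\<And>i. i \<in> F \<Longrightarrow> g i summable_on A"
  shows "(\<Sum>i\<in>F. \<Sum>\<^sub>\<infinity>x\<in>A. g i x) = (\<Sum>\<^sub>\<infinity>x\<in>A. \<Sum>i\<in>F. g i x)"
proof -
  have "((\<lambda>x. \<Sum>i\<in>F. g i x) has_sum (\<Sum>i\<in>F. \<Sum>\<^sub>\<infinity>x\<in>A. g i x)) A"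
    using assms by (induction F rule: finite_induct) (auto intro!: has_sum_add has_sum_infsum)
  then show ?thesis by (simp add: infsumI)
qed

text \<open>For use with 1 / s in place of \<open>Suc n\<close>: the exponential error beats the
  powers of 1 / s in the normalisation of \<open>gkern\<close>. As m <= m^2, the plain exponential
  already suffices.\<close>

lemma power_mult_exp_square_limit:
  fixes \<kappa> a :: real
  assumes "a > 0"
  shows "(\<lambda>n. (\<kappa> * real (Suc n)) ^ d * exp (- (a * (real (Suc n))\<^sup>2))) \<longlonglongrightarrow> 0"
proof (rule Lim_null_comparison)
  have "filterlim (\<lambda>n. a * real (Suc n)) at_top sequentially"
    using assms by (intro filterlim_tendsto_pos_mult_at_top[OF tendsto_const] filterlim_compose[OF filterlim_real_sequentially filterlim_Suc])
  then have "(\<lambda>n. \<bar>\<kappa> / a\<bar> ^ d * ((a * real (Suc n)) ^ d / exp (a * real (Suc n)))) \<longlonglongrightarrow> \<bar>\<kappa> / a\<bar> ^ d * 0"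
    by (intro tendsto_intros filterlim_compose[OF tendsto_power_div_exp_0])
  then show "(\<lambda>n. \<bar>\<kappa> / a\<bar> ^ d * ((a * real (Suc n)) ^ d / exp (a * real (Suc n)))) \<longlonglongrightarrow> 0" by simp
  have "norm ((\<kappa> * real (Suc n)) ^ d * exp (- (a * (real (Suc n))\<^sup>2))) \<le> \<bar>\<kappa> / a\<bar> ^ d * ((a * real (Suc n)) ^ d / exp (a * real (Suc n)))" for n
  proof -
    let ?m = "real (Suc n)"
    have "?m * 1 \<le> ?m * ?m" by (intro mult_left_mono) auto
    then have "a * ?m \<le> a * ?m\<^sup>2" using assms by (simp add: power2_eq_square)
    then have "exp (- (a * ?m\<^sup>2)) \<le> 1 / exp (a * ?m)" by (simp add: exp_minus[symmetric] divide_inverse)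
    have "norm ((\<kappa> * ?m) ^ d * exp (- (a * ?m\<^sup>2))) = \<bar>\<kappa> * ?m\<bar> ^ d * exp (- (a * ?m\<^sup>2))"
      by (simp only: real_norm_def abs_mult[of "_ ^ d"] power_abs abs_exp_cancel)
    also have "\<dots> \<le> \<bar>\<kappa> * ?m\<bar> ^ d * (1 / exp (a * ?m))"
      using \<open>exp (- (a * ?m\<^sup>2)) \<le> 1 / exp (a * ?m)\<close> by (intro mult_left_mono) auto
    also have "\<bar>\<kappa> * ?m\<bar> ^ d = \<bar>\<kappa> / a\<bar> ^ d * (a * ?m) ^ d"
      using assms by (simp add: abs_mult power_mult_distrib[symmetric])
    finally show ?thesis by (simp only: mult.assoc times_divide_eq_right mult_1_right)
  qed
  then show "\<forall>\<^sub>F n in sequentially. norm ((\<kappa> * real (Suc n)) ^ d * exp (- (a * (real (Suc n))\<^sup>2))) \<le> \<bar>\<kappa> / a\<bar> ^ d * ((a * real (Suc n)) ^ d / exp (a * real (Suc n)))"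
    by simp
qed

text \<open>Here |z - l| >= |l| / 2, and pi^2 >= 9 makes the exponent large enough to be split: one
  part yields the factor exp (-eps^2 / s^2), which vanishes as s tends to 0, the other exp (-|l|^2),
  which makes the bound summable over the atoms.\<close>

lemma gkern_off_origin:
  fixes z l :: "'a::euclidean_space"
  assumes "norm z \<le> \<epsilon> / 2" "\<epsilon> \<le> norm l" "0 < \<epsilon>" "0 < s" "s \<le> 1"
  shows "gkern s (z - l) \<le> (sqrt (2 * pi) / s) ^ DIM('a) * exp (- (\<epsilon>\<^sup>2 / s\<^sup>2)) * pkern l"
proof -
  have "norm l \<le> norm (z - l) + norm z"
    using norm_triangle_sub[of l z] by (simp add: norm_minus_commute add.commute)
  then have "norm l / 2 \<le> norm (z - l)" using assms by linarith
  then have "(norm l / 2)\<^sup>2 \<le> (norm (z - l))\<^sup>2" by (rule power_mono) simp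
  then have n: "l \<bullet> l / 4 \<le> (z - l) \<bullet> (z - l)" by (simp add: dot_square_norm power_divide)
  have e: "\<epsilon>\<^sup>2 \<le> l \<bullet> l" using assms by (simp add: dot_square_norm power_mono)
  have "9 \<le> pi\<^sup>2" using power_mono[of 3 pi 2] pi_gt3 by simp
  then have "2 * 9 * (l \<bullet> l / 4) \<le> 2 * pi\<^sup>2 * ((z - l) \<bullet> (z - l))"
    using n by (intro mult_mono) auto
  then have "\<epsilon>\<^sup>2 + l \<bullet> l \<le> 2 * pi\<^sup>2 * ((z - l) \<bullet> (z - l))" using e inner_ge_zero[of l] by linarith
  then have "(\<epsilon>\<^sup>2 + l \<bullet> l) / s\<^sup>2 \<le> 2 * pi\<^sup>2 * ((z - l) \<bullet> (z - l)) / s\<^sup>2"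
    by (intro divide_right_mono) auto
  moreover have "l \<bullet> l * s\<^sup>2 \<le> l \<bullet> l * 1"
    using assms by (intro mult_left_mono power_le_one) auto
  then have "l \<bullet> l \<le> l \<bullet> l / s\<^sup>2" using assms by (simp add: pos_le_divide_eq)
  ultimately have "- (2 * pi\<^sup>2 / s\<^sup>2 * ((z - l) \<bullet> (z - l))) \<le> - (\<epsilon>\<^sup>2 / s\<^sup>2) + - (1 * (l \<bullet> l))"
    by (simp add: add_divide_distrib)
  then have "exp (- (2 * pi\<^sup>2 / s\<^sup>2 * ((z - l) \<bullet> (z - l)))) \<le> exp (- (\<epsilon>\<^sup>2 / s\<^sup>2)) * exp (- (1 * (l \<bullet> l)))"
    by (simp only: exp_add[symmetric] exp_le_cancel_iff)
  also have "\<dots> \<le> exp (- (\<epsilon>\<^sup>2 / s\<^sup>2)) * pkern l"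
    using exp_le_pkern[of 1 l] by (intro mult_left_mono) auto
  finally have "exp (- (2 * pi\<^sup>2 / s\<^sup>2 * ((z - l) \<bullet> (z - l)))) \<le> exp (- (\<epsilon>\<^sup>2 / s\<^sup>2)) * pkern l" .
  then show ?thesis
    unfolding gkern_alt mult.assoc using assms by (intro mult_left_mono) auto
qed

text \<open>Integrate the duality for Gaussians modulated by w + z against box_tent z * chr z x in z and let
  their width tend to infinity; all atoms of mu other than w drop out. As the right-hand side does not
  depend on x, the kernel may be centred anywhere.\<close>
lemma atom_from_fourier_transform:
  fixes \<Lambda> \<Gamma> :: "'a::euclidean_space set" and c b :: "'a \<Rightarrow> complex" and \<epsilon> \<eta> :: real
  assumes \<Gamma>: "countable \<Gamma>" and c: "translation_bounded c" and b: "translation_bounded b"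
    and duality: "\<And>\<phi>. schwartz \<phi> \<Longrightarrow>
           (\<Sum>\<^sub>\<infinity>\<gamma>\<in>\<Gamma>. b \<gamma> * \<phi> \<gamma>) = (\<Sum>\<^sub>\<infinity>l\<in>\<Lambda>. c l * fourier_transform \<phi> l)"
    and \<epsilon>: "\<epsilon> > 0" and w: "w \<in> \<Lambda>" "\<And>l. l \<in> \<Lambda> \<Longrightarrow> l \<noteq> w \<Longrightarrow> \<epsilon> \<le> dist l w"
    and \<eta>: "0 \<le> \<eta>" "DIM('a) * \<eta> \<le> \<epsilon> / 2"
  shows "(\<Sum>\<^sub>\<infinity>\<gamma>\<in>\<Gamma>. b \<gamma> * band_kernel \<eta> (\<gamma> + x) * chr w \<gamma>) = of_real (\<eta> ^ DIM('a)) * c w"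
proof -
  obtain Cb where Cb: "\<And>x \<Gamma>. (\<lambda>g. norm (b g) * pkern (g + x)) summable_on \<Gamma>"
     "\<And>x \<Gamma>. (\<Sum>\<^sub>\<infinity>g\<in>\<Gamma>. norm (b g) * pkern (g + x)) \<le> Cb"
    using translation_bounded_summable[OF b] by blast
  obtain Cc where Cc: "\<And>x \<Gamma>. (\<lambda>g. norm (c g) * pkern (g + x)) summable_on \<Gamma>"
     "\<And>x \<Gamma>. (\<Sum>\<^sub>\<infinity>g\<in>\<Gamma>. norm (c g) * pkern (g + x)) \<le> Cc"
    using translation_bounded_summable[OF c] by blast
  \<comment> \<open>The wanted sum with a Gaussian damping factor; \<open>S 0\<close> is the sum
    itself.\<close>
  define S where "S s = (\<Sum>\<^sub>\<infinity>\<gamma>\<in>\<Gamma>. b \<gamma> * of_real (exp (- (s\<^sup>2 / 2 * (\<gamma> \<bullet> \<gamma>)))) * band_kernel \<eta> (\<gamma> + x) * chr w \<gamma>)" for s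
  define q where "q z = complex_of_real (box_tent \<eta> z) * chr z x" for z
  define I where "I s = (\<integral>z. of_real (box_tent \<eta> z) * (chr z x * of_real (gkern s z)) \<partial>lborel)" for s
  \<comment> \<open>Bound for the joint contribution of all atoms of mu other than the one at
    w.\<close>
  define er where "er s = (sqrt (2 * pi) / s) ^ DIM('a) * exp (- (\<epsilon>\<^sup>2 / s\<^sup>2)) * Cc" for s
  define J where "J = integral\<^sup>L lborel (box_tent \<eta> :: 'a \<Rightarrow> real)"
  have meas_q [measurable]: "q \<in> borel_measurable borel"
    unfolding q_def chr_def by measurable

  have close: "norm (S s - c w * I s) \<le> er s * J" if s: "0 < s" "s \<le> 1"
      and intI: "integrable lborel (\<lambda>z::'a. of_real (box_tent \<eta> z) * (chr z x * of_real (gkern s z)))" for s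
  proof -
    have star: "(\<Sum>\<^sub>\<infinity>\<gamma>\<in>\<Gamma>. b \<gamma> * gauss (s\<^sup>2 / 2) \<xi> \<gamma>) = (\<Sum>\<^sub>\<infinity>l\<in>\<Lambda>. c l * of_real (gkern s (\<xi> - l)))" for \<xi>
      using duality[OF schwartz_gauss[of "s\<^sup>2 / 2" \<xi>]] s by (simp add: fourier_transform_gauss)
    define f where "f \<gamma> z = q z * (b \<gamma> * gauss (s\<^sup>2 / 2) (w + z) \<gamma>)" for \<gamma> z
    have f_eq: "f \<gamma> z = (b \<gamma> * of_real (exp (- (s\<^sup>2 / 2 * (\<gamma> \<bullet> \<gamma>)))) * chr w \<gamma>) * (of_real (box_tent \<eta> z) * chr z (\<gamma> + x))" for \<gamma> z
    proof -
      have "chr (w + z) \<gamma> = chr w \<gamma> * chr z \<gamma>"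
        by (metis chr_add chr_commute)
      then show ?thesis by (simp add: f_def q_def gauss_def chr_add)
    qed
    \<comment> \<open>Integrating out the modulation z against the tent and \<open>chr z x\<close>
      turns the family of Gaussians into a single damped kernel at
      \<open>\<gamma> + x\<close>.\<close>
    have int_f: "(\<integral>z. f \<gamma> z \<partial>lborel) = b \<gamma> * of_real (exp (- (s\<^sup>2 / 2 * (\<gamma> \<bullet> \<gamma>)))) * band_kernel \<eta> (\<gamma> + x) * chr w \<gamma>" for \<gamma>
      unfolding f_eq band_kernel_def by simp
    define K where "K = (1 / (s\<^sup>2 / 2)) ^ DIM('a)"
    have bound: "norm (f \<gamma> z) \<le> K * (norm (b \<gamma>) * pkern (\<gamma> + 0)) * box_tent \<eta> z" for \<gamma> z
    proof -
      have "s\<^sup>2 / 2 \<le> 1" using power_le_one[of s 2] s by simp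
      then have "exp (- (s\<^sup>2 / 2 * (\<gamma> \<bullet> \<gamma>))) \<le> K * pkern \<gamma>"
        using s unfolding K_def by (intro exp_le_pkern) auto
      then have "norm (b \<gamma>) * exp (- (s\<^sup>2 / 2 * (\<gamma> \<bullet> \<gamma>))) * box_tent \<eta> z \<le> norm (b \<gamma>) * (K * pkern \<gamma>) * box_tent \<eta> z"
        by (intro mult_right_mono mult_left_mono box_tent_nonneg) auto
      then show ?thesis unfolding f_eq by (simp add: norm_mult box_tent_nonneg mult_ac)
    qed
    have meas: "f \<gamma> \<in> borel_measurable borel" for \<gamma>
      unfolding f_eq chr_def by measurable
    note swap = \<Gamma> meas bound summable_on_cmult_right[OF Cb(1)] integrable_box_tent[OF \<eta>(1)]
    have intf: "integrable lborel (\<lambda>z. \<Sum>\<^sub>\<infinity>\<gamma>\<in>\<Gamma>. f \<gamma> z)"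
      by (rule integrable_infsum[OF swap])
    have S: "S s = (\<integral>z. (\<Sum>\<^sub>\<infinity>\<gamma>\<in>\<Gamma>. f \<gamma> z) \<partial>lborel)"
      unfolding S_def integral_infsum[OF swap] int_f ..
    \<comment> \<open>Only z in the support of the tent matter, and for these |z| is at most half
      the distance from w to the other atoms.\<close>
    have pointwise: "norm ((\<Sum>\<^sub>\<infinity>\<gamma>\<in>\<Gamma>. f \<gamma> z) - c w * (of_real (box_tent \<eta> z) * (chr z x * of_real (gkern s z)))) \<le> er s * box_tent \<eta> z" for z
    proof (cases "box_tent \<eta> z = 0")
      case True
      then show ?thesis by (simp add: f_def q_def)
    next
      case False
      then have z: "norm z \<le> \<epsilon> / 2" using norm_le_of_box_tent[OF False] \<eta>(2) by linarith
      define E where "E = (sqrt (2 * pi) / s) ^ DIM('a) * exp (- (\<epsilon>\<^sup>2 / s\<^sup>2))"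
      have "E \<ge> 0" using s by (simp add: E_def)
      have le: "norm (c l * of_real (gkern s (w + z - l))) \<le> E * (norm (c l) * pkern (l + (- w)))" if "l \<in> \<Lambda> - {w}" for l
      proof -
        have "\<epsilon> \<le> norm (l - w)" using w(2)[of l] that by (simp add: dist_norm)
        then have "gkern s (z - (l - w)) \<le> E * pkern (l - w)"
          unfolding E_def using z \<epsilon> s by (intro gkern_off_origin)
        moreover have "gkern s (w + z - l) \<ge> 0" using s by (simp add: gkern_alt)
        ultimately show ?thesis
          using mult_left_mono[of "gkern s (z - (l - w))" "E * pkern (l - w)" "norm (c l)"]
          by (simp add: norm_mult algebra_simps)
      qed
      have summ: "(\<lambda>l. norm (c l * of_real (gkern s (w + z - l)))) summable_on (\<Lambda> - {w})"
        by (rule summable_on_comparison_test[OF summable_on_cmult_right[OF Cc(1)] le]) auto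
      define rest where "rest = (\<Sum>\<^sub>\<infinity>l\<in>\<Lambda> - {w}. c l * of_real (gkern s (w + z - l)))"
      have "norm rest \<le> (\<Sum>\<^sub>\<infinity>l\<in>\<Lambda> - {w}. E * (norm (c l) * pkern (l + (- w))))"
        unfolding rest_def
        by (rule norm_infsum_le[OF has_sum_infsum[OF abs_summable_summable[OF summ]]
              has_sum_infsum[OF summable_on_cmult_right[OF Cc(1)]] le])
      also have "\<dots> \<le> E * Cc"
        unfolding infsum_cmult_right' using Cc(2) \<open>E \<ge> 0\<close> by (intro mult_left_mono)
      finally have rest: "norm rest \<le> er s" by (simp add: er_def E_def)
      have "(\<Sum>\<^sub>\<infinity>l\<in>insert w (\<Lambda> - {w}). c l * of_real (gkern s (w + z - l))) = c w * of_real (gkern s (w + z - w)) + rest"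
        unfolding rest_def by (rule infsum_insert[OF abs_summable_summable[OF summ]]) simp
      then have "(\<Sum>\<^sub>\<infinity>l\<in>\<Lambda>. c l * of_real (gkern s (w + z - l))) = c w * of_real (gkern s z) + rest"
        using w(1) by (simp add: insert_absorb)
      then have "(\<Sum>\<^sub>\<infinity>\<gamma>\<in>\<Gamma>. f \<gamma> z) = q z * (c w * of_real (gkern s z) + rest)"
        unfolding f_def infsum_cmult_right' star by simp
      then have "(\<Sum>\<^sub>\<infinity>\<gamma>\<in>\<Gamma>. f \<gamma> z) - c w * (of_real (box_tent \<eta> z) * (chr z x * of_real (gkern s z))) = q z * rest"
        by (simp add: q_def algebra_simps)
      also have "norm \<dots> = box_tent \<eta> z * norm rest"
        by (simp add: q_def norm_mult box_tent_nonneg)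
      also have "\<dots> \<le> box_tent \<eta> z * er s" using rest box_tent_nonneg by (rule mult_left_mono)
      finally show ?thesis by (simp add: mult.commute)
    qed
    have "S s - c w * I s = (\<integral>z. (\<Sum>\<^sub>\<infinity>\<gamma>\<in>\<Gamma>. f \<gamma> z) - c w * (of_real (box_tent \<eta> z) * (chr z x * of_real (gkern s z))) \<partial>lborel)"
      unfolding S I_def using intf intI by simp
    also have "norm \<dots> \<le> (\<integral>z. er s * box_tent \<eta> (z::'a) \<partial>lborel)"
    proof (rule order_trans[OF integral_norm_bound integral_mono])
      show "integrable lborel (\<lambda>z. norm ((\<Sum>\<^sub>\<infinity>\<gamma>\<in>\<Gamma>. f \<gamma> z) - c w * (of_real (box_tent \<eta> z) * (chr z x * of_real (gkern s z)))))"
        by (intro integrable_norm Bochner_Integration.integrable_diff intf integrable_mult_right intI)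
      show "integrable lborel (\<lambda>z::'a. er s * box_tent \<eta> z)"
        by (intro integrable_mult_right integrable_box_tent \<eta>)
    qed (rule pointwise)
    finally show ?thesis by (simp add: J_def)
  qed

  \<comment> \<open>The shift by one keeps s in (0, 1], the range of the estimate above.\<close>
  define s where "s n = 1 / real (Suc n)" for n
  have s: "0 < s n" "s n \<le> 1" for n by (auto simp: s_def)
  have s0: "s \<longlonglongrightarrow> 0" unfolding s_def by (rule LIMSEQ_inverse_real_of_nat[unfolded inverse_eq_divide])
  have I: "(\<lambda>n. I (s n)) \<longlonglongrightarrow> of_real (\<eta> ^ DIM('a))"
    unfolding I_def by (rule box_tent_gkern_limit(1)[OF \<eta>(1) s(1) s0])
  have "(\<lambda>n. er (s n)) \<longlonglongrightarrow> 0 * Cc"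
  proof -
    have "(\<lambda>n. (sqrt (2 * pi) * real (Suc n)) ^ DIM('a) * exp (- (\<epsilon>\<^sup>2 * (real (Suc n))\<^sup>2)) * Cc) \<longlonglongrightarrow> 0 * Cc"
      using \<epsilon> by (intro tendsto_intros power_mult_exp_square_limit) simp
    moreover have "er (s n) = (sqrt (2 * pi) * real (Suc n)) ^ DIM('a) * exp (- (\<epsilon>\<^sup>2 * (real (Suc n))\<^sup>2)) * Cc" for n
      by (simp only: er_def s_def divide_divide_eq_right div_by_1 power_divide power_one mult_1_right)
    ultimately show ?thesis by (simp only:)
  qed
  then have "(\<lambda>n. er (s n) * J) \<longlonglongrightarrow> 0 * Cc * J" by (intro tendsto_intros)
  then have "(\<lambda>n. er (s n) * J) \<longlonglongrightarrow> 0" by simp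
  moreover have "\<forall>\<^sub>F n in sequentially. norm (S (s n) - c w * I (s n)) \<le> er (s n) * J"
    by (intro always_eventually allI close[OF s box_tent_gkern_limit(2)[OF \<eta>(1) s(1) s0]])
  ultimately have "(\<lambda>n. S (s n) - c w * I (s n)) \<longlonglongrightarrow> 0"
    by (rule Lim_null_comparison[rotated])
  then have "(\<lambda>n. (S (s n) - c w * I (s n)) + c w * I (s n)) \<longlonglongrightarrow> 0 + c w * of_real (\<eta> ^ DIM('a))"
    by (intro tendsto_intros I)
  then have lim1: "(\<lambda>n. S (s n)) \<longlonglongrightarrow> c w * of_real (\<eta> ^ DIM('a))" by simp

  obtain D where D: "D \<ge> 0" "\<And>y::'a. norm (band_kernel \<eta> y) \<le> D * pkern y"
    using band_kernel_decay[OF \<eta>(1)] by blast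
  \<comment> \<open>Damping can be removed under the sum: the Gaussian factor is at most 1, so the
    series converges uniformly in s and S is continuous at 0.\<close>
  have "uniform_limit UNIV (\<lambda>X s. \<Sum>\<gamma>\<in>X. b \<gamma> * of_real (exp (- (s\<^sup>2 / 2 * (\<gamma> \<bullet> \<gamma>)))) * band_kernel \<eta> (\<gamma> + x) * chr w \<gamma>) S (finite_subsets_at_top \<Gamma>)"
    unfolding S_def
  proof (rule Weierstrass_m_test_general)
    fix \<gamma> and s :: real
    have "norm (b \<gamma>) * exp (- (s\<^sup>2 / 2 * (\<gamma> \<bullet> \<gamma>))) * norm (band_kernel \<eta> (\<gamma> + x)) \<le> norm (b \<gamma>) * 1 * (D * pkern (\<gamma> + x))"
      by (intro mult_mono D) auto
    then show "norm (b \<gamma> * of_real (exp (- (s\<^sup>2 / 2 * (\<gamma> \<bullet> \<gamma>)))) * band_kernel \<eta> (\<gamma> + x) * chr w \<gamma>) \<le> D * (norm (b \<gamma>) * pkern (\<gamma> + x))"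
      by (simp add: norm_mult mult_ac)
  qed (intro summable_on_cmult_right Cb)
  then have "continuous_on UNIV S"
    by (rule uniform_limit_theorem[rotated]) (auto intro!: always_eventually continuous_intros)
  then have "isCont S 0" by (simp add: continuous_on_eq_continuous_at)
  then have "(\<lambda>n. S (s n)) \<longlonglongrightarrow> S 0" using s0 by (rule isCont_tendsto_compose)
  with lim1 have "S 0 = c w * of_real (\<eta> ^ DIM('a))" using LIMSEQ_unique by blast
  then show ?thesis by (simp add: S_def mult_ac)
qed

theorem theorem9:
  fixes \<Lambda> \<Gamma> U :: "'a::euclidean_space set"
    and c b :: "'a \<Rightarrow> complex"
    and \<epsilon> :: real
  assumes "countable \<Lambda>" and "\<forall>x. x \<notin> \<Lambda> \<longrightarrow> c x = 0" and "translation_bounded c"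
    and "countable \<Gamma>" and "\<forall>x. x \<notin> \<Gamma> \<longrightarrow> b x = 0" and "translation_bounded b"
    and "\<forall>\<phi>. schwartz \<phi> \<longrightarrow>
           (\<Sum>\<^sub>\<infinity>\<gamma>\<in>\<Gamma>. b \<gamma> * \<phi> \<gamma>) = (\<Sum>\<^sub>\<infinity>l\<in>\<Lambda>. c l * fourier_transform \<phi> l)"
    and "U \<subseteq> \<Lambda>" and "\<epsilon> > 0"
    and "\<forall>l\<in>U. norm (c l) \<ge> \<epsilon>"
    and "\<forall>l\<in>U. \<forall>l'\<in>\<Lambda> - {l}. dist l l' \<ge> \<epsilon>"
  shows "coherent_frequencies U"
proof -
  \<comment> \<open>The largest half-side for which the cube estimate gives radius eps / 2.\<close>
  define \<eta> where "\<eta> = \<epsilon> / (2 * DIM('a))"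
  have \<eta>: "\<eta> > 0" "DIM('a) * \<eta> \<le> \<epsilon> / 2" using assms(9) by (auto simp: \<eta>_def)
  define \<kappa> where "\<kappa> = \<eta> ^ DIM('a)"
  have "\<kappa> > 0" using \<eta> by (simp add: \<kappa>_def)
  have atom: "(\<Sum>\<^sub>\<infinity>\<gamma>\<in>\<Gamma>. b \<gamma> * band_kernel \<eta> (\<gamma> + x) * chr w \<gamma>) = of_real \<kappa> * c w" if "w \<in> U" for w x
    unfolding \<kappa>_def using assms \<eta> that
    by (intro atom_from_fourier_transform[where \<Lambda> = \<Lambda> and \<epsilon> = \<epsilon>]) (auto simp: dist_commute)
  obtain D where D: "D \<ge> 0" "\<And>y::'a. norm (band_kernel \<eta> y) \<le> D * pkern y"
    using band_kernel_decay[OF less_imp_le[OF \<eta>(1)]] by blast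
  obtain Cb where Cb: "\<And>x \<Gamma>. (\<lambda>g. norm (b g) * pkern (g + x)) summable_on \<Gamma>"
     "\<And>x \<Gamma>. (\<Sum>\<^sub>\<infinity>g\<in>\<Gamma>. norm (b g) * pkern (g + x)) \<le> Cb"
    using translation_bounded_summable[OF assms(6)] by blast
  have le: "norm (b \<gamma> * band_kernel \<eta> (\<gamma> + x)) \<le> D * (norm (b \<gamma>) * pkern (\<gamma> + x))" for \<gamma> x
    using mult_left_mono[OF D(2)[of "\<gamma> + x"], of "norm (b \<gamma>)"] by (simp add: norm_mult mult_ac)
  have summ: "(\<lambda>\<gamma>. norm (b \<gamma> * band_kernel \<eta> (\<gamma> + x))) summable_on \<Gamma>" for x
    by (rule summable_on_comparison_test[OF summable_on_cmult_right[OF Cb(1)] le]) auto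
  \<comment> \<open>The atom identity at x = 0 read as a function of w: an absolutely convergent sum
    of characters on the whole space that equals kappa c(w) on U.\<close>
  define f where "f w = (\<Sum>\<^sub>\<infinity>\<gamma>\<in>\<Gamma>. b \<gamma> * band_kernel \<eta> \<gamma> * chr w \<gamma>)" for w
  have f: "f w = of_real \<kappa> * c w" if "w \<in> U" for w
    using atom[OF that, of 0] by (simp add: f_def)
  have "invertible_on f U"
  proof (rule wiener_inverse)
    show "(\<lambda>\<gamma>. norm (b \<gamma> * band_kernel \<eta> \<gamma>)) summable_on \<Gamma>" using summ[of 0] by simp
    show "f w = (\<Sum>\<^sub>\<infinity>\<gamma>\<in>\<Gamma>. b \<gamma> * band_kernel \<eta> \<gamma> * chr w \<gamma>)" for w by (rule f_def)
    show "norm (f w) \<ge> \<kappa> * \<epsilon>" if "w \<in> U" for w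
      using assms(10) that \<open>\<kappa> > 0\<close> by (simp add: f norm_mult)
    show "\<kappa> * \<epsilon> > 0" using \<open>\<kappa> > 0\<close> assms(9) by simp
  qed
  then obtain s Cs where s: "fmult s Cs" "\<And>w. w \<in> U \<Longrightarrow> s w * f w = 1"
    unfolding invertible_on_def by blast
  have "Cs \<ge> 0" using s(1) by (rule fmult_nonneg)
  \<comment> \<open>Makes Cs D delta at most 1/2, so that the far part can be absorbed; the added
    ones avoid division by 0.\<close>
  define \<delta> where "\<delta> = 1 / (2 * (Cs + 1) * (D + 1))"
  have "\<delta> > 0" using \<open>Cs \<ge> 0\<close> D(1) by (simp add: \<delta>_def)
  have \<delta>: "Cs * (D * \<delta>) \<le> 1 / 2"
  proof -
    have "Cs * D \<le> (Cs + 1) * (D + 1)" using \<open>Cs \<ge> 0\<close> D(1) by (intro mult_mono) auto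
    then have "Cs * D * \<delta> \<le> (Cs + 1) * (D + 1) * \<delta>" using \<open>\<delta> > 0\<close> by (intro mult_right_mono) auto
    also have "\<dots> = 1 / 2" using \<open>Cs \<ge> 0\<close> D(1) by (simp add: \<delta>_def)
    finally show ?thesis by (simp only: mult.assoc)
  qed
  obtain R where R: "\<And>x \<Gamma>. (\<Sum>\<^sub>\<infinity>g\<in>{g\<in>\<Gamma>. norm (g + x) > R}. norm (b g) * pkern (g + x)) \<le> \<delta>"
    using translation_bounded_tail[OF assms(6) \<open>\<delta> > 0\<close>] by blast
  show ?thesis
  proof (rule coherent_frequenciesI)
    show "uniformly_discrete U"
      unfolding uniformly_discrete_def using assms(8,9,11) by blast
    \<comment> \<open>The origin is inserted in case R is negative and the ball empty; its presence
      forces B >= 0.\<close>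
    show "compact (insert 0 (cball (0::'a) R))" by simp
    fix P B x assume P: "exp_poly U P" and B: "\<And>x. x \<in> insert 0 (cball 0 R) \<Longrightarrow> norm (P x) \<le> B"
    have "\<bar>B\<bar> = B" using B[of 0] norm_ge_zero[of "P 0"] by (simp only: abs_of_nonneg order_trans[of 0 "norm (P 0)" B] insert_iff simp_thms)
    obtain F a where F: "finite F" "F \<subseteq> U" "P = (\<lambda>x. \<Sum>w\<in>F. a w * chr w x)"
      using P by (auto simp: exp_poly_alt)
    have bdd: "bdd_above (range (\<lambda>x. norm (P x)))"
      unfolding F(3) by (rule bdd_aboveI[of _ "\<Sum>w\<in>F. norm (a w)"])
        (auto intro!: sum_norm_le simp: norm_mult)
    \<comment> \<open>Finite because P is a finite sum of exponentials; otherwise the final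
      absorption would be void.\<close>
    define S where "S = (SUP x. norm (P x))"
    have S: "norm (P x) \<le> S" for x unfolding S_def by (rule cSUP_upper[OF _ bdd]) simp
    have "S \<ge> 0" using S[of 0] norm_ge_zero order_trans by blast
    have Q: "norm (\<Sum>w\<in>F. (a w * f w) * chr w x) \<le> D * (Cb * \<bar>B\<bar> + \<delta> * S)" for x
    proof -
      \<comment> \<open>At points \<open>\<gamma> + x\<close> of the ball |P| is at most B, at all
        others only the global bound S is available. The near majorant is summed over all of
        \<open>\<Gamma>\<close>, the far one over the tail.\<close>
      define near where "near \<gamma> = D * \<bar>B\<bar> * (norm (b \<gamma>) * pkern (\<gamma> + x))" for \<gamma>
      define far where "far \<gamma> = (if norm (\<gamma> + x) > R then D * S * (norm (b \<gamma>) * pkern (\<gamma> + x)) else 0)" for \<gamma>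
      have near: "near summable_on \<Gamma>" unfolding near_def by (intro summable_on_cmult_right Cb)
      have far: "far summable_on \<Gamma>"
        by (rule summable_on_comparison_test[OF summable_on_cmult_right[OF Cb(1)[of x], of "D * S"]])
           (use D(1) \<open>S \<ge> 0\<close> in \<open>auto simp: far_def intro!: mult_nonneg_nonneg less_imp_le[OF pkern_pos]\<close>)
      have sumw: "(\<lambda>\<gamma>. b \<gamma> * band_kernel \<eta> (\<gamma> + x) * chr w \<gamma>) summable_on \<Gamma>" for w
        by (rule abs_summable_summable) (use summ[of x] in \<open>simp add: norm_mult\<close>)
      have "(\<Sum>w\<in>F. (a w * f w) * chr w x) = (\<Sum>w\<in>F. \<Sum>\<^sub>\<infinity>\<gamma>\<in>\<Gamma>. (a w * chr w x) * (b \<gamma> * band_kernel \<eta> (\<gamma> + x) * chr w \<gamma>))"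
      proof (rule sum.cong)
        fix w assume "w \<in> F"
        \<comment> \<open>The kernel may be centred at -x for each x without changing the value f w.
          Hence the coefficients of Q are constant while its local expansion follows x.\<close>
        then have "f w = (\<Sum>\<^sub>\<infinity>\<gamma>\<in>\<Gamma>. b \<gamma> * band_kernel \<eta> (\<gamma> + x) * chr w \<gamma>)"
          using f[of w] atom[of w x] F(2) by auto
        then show "(a w * f w) * chr w x = (\<Sum>\<^sub>\<infinity>\<gamma>\<in>\<Gamma>. (a w * chr w x) * (b \<gamma> * band_kernel \<eta> (\<gamma> + x) * chr w \<gamma>))"
          unfolding infsum_cmult_right' by simp
      qed simp
      also have "\<dots> = (\<Sum>\<^sub>\<infinity>\<gamma>\<in>\<Gamma>. \<Sum>w\<in>F. (a w * chr w x) * (b \<gamma> * band_kernel \<eta> (\<gamma> + x) * chr w \<gamma>))"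
        by (rule sum_infsum_swap) (intro F(1) summable_on_cmult_right sumw)+
      also have "\<dots> = (\<Sum>\<^sub>\<infinity>\<gamma>\<in>\<Gamma>. (b \<gamma> * band_kernel \<eta> (\<gamma> + x)) * P (\<gamma> + x))"
        unfolding F(3) by (intro infsum_cong) (simp add: sum_distrib_left chr_add mult_ac)
      also have "norm \<dots> \<le> (\<Sum>\<^sub>\<infinity>\<gamma>\<in>\<Gamma>. near \<gamma> + far \<gamma>)"
      proof (rule norm_infsum_le[OF has_sum_infsum has_sum_infsum])
        show "(\<lambda>\<gamma>. near \<gamma> + far \<gamma>) summable_on \<Gamma>" using near far by (rule summable_on_add)
        show le': "norm (b \<gamma> * band_kernel \<eta> (\<gamma> + x) * P (\<gamma> + x)) \<le> near \<gamma> + far \<gamma>" for \<gamma>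
        proof (cases "norm (\<gamma> + x) > R")
          case True
          have "norm (b \<gamma> * band_kernel \<eta> (\<gamma> + x) * P (\<gamma> + x)) \<le> D * (norm (b \<gamma>) * pkern (\<gamma> + x)) * S"
            unfolding norm_mult[of _ "P (\<gamma> + x)"] by (intro mult_mono le S) (use D(1) pkern_pos[of "\<gamma> + x"] in auto)
          then show ?thesis using True D(1) pkern_pos[of "\<gamma> + x"] by (simp add: near_def far_def mult_ac add_increasing)
        next
          case False
          then have "norm (P (\<gamma> + x)) \<le> \<bar>B\<bar>" using B[of "\<gamma> + x"] by simp
          then have "norm (b \<gamma> * band_kernel \<eta> (\<gamma> + x) * P (\<gamma> + x)) \<le> D * (norm (b \<gamma>) * pkern (\<gamma> + x)) * \<bar>B\<bar>"
            unfolding norm_mult[of _ "P (\<gamma> + x)"] by (intro mult_mono le) (use D(1) pkern_pos[of "\<gamma> + x"] in auto)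
          then show ?thesis using False by (simp add: near_def far_def mult_ac)
        qed
        show "(\<lambda>\<gamma>. b \<gamma> * band_kernel \<eta> (\<gamma> + x) * P (\<gamma> + x)) summable_on \<Gamma>"
          by (rule abs_summable_summable, rule summable_on_comparison_test[OF summable_on_add[OF near far] le']) auto
      qed
      also have "\<dots> = infsum near \<Gamma> + infsum far \<Gamma>" using near far by (rule infsum_add)
      also have "\<dots> \<le> D * \<bar>B\<bar> * Cb + D * S * \<delta>"
      proof (rule add_mono)
        show "infsum near \<Gamma> \<le> D * \<bar>B\<bar> * Cb"
          unfolding near_def infsum_cmult_right' using D(1) Cb(2) by (intro mult_left_mono) auto
        have "infsum far \<Gamma> = (\<Sum>\<^sub>\<infinity>\<gamma>\<in>{\<gamma>\<in>\<Gamma>. norm (\<gamma> + x) > R}. D * S * (norm (b \<gamma>) * pkern (\<gamma> + x)))"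
          by (rule infsum_cong_neutral) (auto simp: far_def)
        also have "\<dots> \<le> D * S * \<delta>"
          unfolding infsum_cmult_right' using D(1) \<open>S \<ge> 0\<close> R by (intro mult_left_mono) auto
        finally show "infsum far \<Gamma> \<le> D * S * \<delta>" .
      qed
      also have "\<dots> = D * (Cb * \<bar>B\<bar> + \<delta> * S)" by (simp add: algebra_simps)
      finally show ?thesis .
    qed
    have "norm (P x) \<le> Cs * (D * (Cb * \<bar>B\<bar> + \<delta> * S))" for x
    proof -
      have "P x = (\<Sum>w\<in>F. (a w * f w) * s w * chr w x)"
        unfolding F(3) using s(2) F(2) by (intro sum.cong) (auto simp: mult_ac dest: subsetD)
      also have "norm \<dots> \<le> Cs * (D * (Cb * \<bar>B\<bar> + \<delta> * S))"
        by (rule fmultD[OF s(1) F(1) Q])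
      finally show ?thesis .
    qed
    \<comment> \<open>Applying the inverse multiplier to Q bounds S by a multiple of B plus S /
      2.\<close>
    then have "S \<le> Cs * (D * (Cb * \<bar>B\<bar> + \<delta> * S))"
      unfolding S_def by (intro cSUP_least) auto
    also have "\<dots> = Cs * D * Cb * \<bar>B\<bar> + Cs * (D * \<delta>) * S" by (simp add: algebra_simps)
    also have "\<dots> \<le> Cs * D * Cb * \<bar>B\<bar> + 1 / 2 * S"
      using mult_right_mono[OF \<delta> \<open>S \<ge> 0\<close>] by linarith
    finally have "S \<le> 2 * Cs * D * Cb * B" unfolding \<open>\<bar>B\<bar> = B\<close> by simp
    then show "norm (P x) \<le> (2 * Cs * D * Cb) * B"
      by (rule order_trans[OF S])
  qed
qed

end
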